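(* Let $X$ be a compact metric space with metric $\rho$, $T\colon X\to X$ a homeomorphism, and $(\mu_m)_{m=1}^\infty$ a sequence of ergodic $T$-invariant Borel probability measures on $X$. The following conditions are equivalent: (1) There is $\mu\in\mathcal{M}_T(X)$ such that $\bar\rho(\mu_m,\mu)\to0$ as $m\to\infty$. (2) There exist $(x_m)_{m=1}^\infty\subseteq X$ and $x\in X$ such that $x_m\in\operatorname{Gen}(\mu_m)$ for every $m\ge1$ and $\lim_{m\to\infty}D_B(x,x_m)=0$. (3) There exist a strictly increasing sequence $(n_k)\subseteq\mathbb{N}$, a sequence $(y_m)_{m=1}^\infty\subseteq X$ such that $y_m$ is quasi-generic for $\mu_m$ along $(n_k)$ for every $m\ge1$, and $y\in X$, such that $\lim_{m\to\infty}D_B^{(n_k)}(y,y_m)=0$. If one, hence every, condition above holds, then the measure $\mu$ in (1) is ergodic, the point $x$ in (2) satisfies $x\in\operatorname{Gen}(\mu)$, and the point $y$ in (3) is quasi-generic for $\mu$ along $(n_k)$. In addition, the points $x$ and $(x_m)_{m=1}^\infty$ in (2) can be chosen so that for every $m\ge1$ $$D_B(x,x_m)=\lim_{n\to\infty}\frac1n\sum_{j=0}^{n-1}\rho(T^j(x),T^j(x_m))=\bar\rho(\mu_m,\mu).$$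
   Context: $\mathcal{M}_T(X)$ is the set of $T$-invariant Borel probability measures on $X$. A point $x\in X$ is quasi-generic for $\mu$ along $(n_k)$ if $\lim_{k\to\infty}\frac1{n_k}\sum_{j=0}^{n_k-1}f(T^j(x))=\int f\,d\mu$ for every continuous $f\colon X\to\mathbb{C}$; it is generic for $\mu$ if this holds with $n_k=k$, and $\operatorname{Gen}(\mu)$ is the set of generic points for $\mu$. $D_B^{(n_k)}(x,x')=\limsup_{k\to\infty}\frac1{n_k}\sum_{j=0}^{n_k-1}\rho(T^j(x),T^j(x'))$, and $D_B$ is $D_B^{(n_k)}$ with $n_k=k$. $J(\mu,\nu)$ is the set of $T\times T$-invariant Borel probability measures on $X\times X$ with marginals $\mu$ and $\nu$, and $\bar\rho(\mu,\nu)=\inf_{\lambda\in J(\mu,\nu)}\int_{X\times X}\rho(x,y)\,d\lambda(x,y)$, which is a metric on $\mathcal{M}_T(X)$. *)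

theory Defs
  imports "HOL-Probability.Probability"
begin

text \<open>
  The compact metric space \<open>X\<close> is a type of class \<^class>\<open>metric_space\<close> (with \<^const>\<open>compact\<close>
  universe) and its metric is \<^const>\<open>dist\<close>.
\<close>

definition invariant_measures :: "('a::topological_space \<Rightarrow> 'a) \<Rightarrow> 'a measure set" where
  "invariant_measures T = {\<mu>. sets \<mu> = sets borel \<and> prob_space \<mu> \<and> distr \<mu> borel T = \<mu>}"

definition ergodic_measure :: "('a::topological_space \<Rightarrow> 'a) \<Rightarrow> 'a measure \<Rightarrow> bool" where
  "ergodic_measure T \<mu> \<longleftrightarrow> \<mu> \<in> invariant_measures T \<and>
     (\<forall>A\<in>sets borel. T -` A = A \<longrightarrow> measure \<mu> A = 0 \<or> measure \<mu> A = 1)"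

definition quasi_generic ::
    "('a::topological_space \<Rightarrow> 'a) \<Rightarrow> (nat \<Rightarrow> nat) \<Rightarrow> 'a measure \<Rightarrow> 'a \<Rightarrow> bool" where
  "quasi_generic T n \<mu> x \<longleftrightarrow>
     (\<forall>f :: 'a \<Rightarrow> complex. continuous_on UNIV f \<longrightarrow>
        (\<lambda>k. (1 / of_nat (n k)) * (\<Sum>j<n k. f ((T ^^ j) x)))
          \<longlonglongrightarrow> integral\<^sup>L \<mu> f)"

text \<open>The sequence \<open>n\<^sub>k = k\<close> is taken to start at \<open>k = 0\<close>; the resulting term \<open>1 / 0 = 0\<close> does not
  affect limits and upper limits.\<close>

definition Gen :: "('a::topological_space \<Rightarrow> 'a) \<Rightarrow> 'a measure \<Rightarrow> 'a set" where
  "Gen T \<mu> = {x. quasi_generic T (\<lambda>k. k) \<mu> x}"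

definition orbit_dist_avg :: "('a::metric_space \<Rightarrow> 'a) \<Rightarrow> 'a \<Rightarrow> 'a \<Rightarrow> nat \<Rightarrow> real" where
  "orbit_dist_avg T x x' n = (1 / real n) * (\<Sum>j<n. dist ((T ^^ j) x) ((T ^^ j) x'))"

text \<open>Valued in \<^typ>\<open>ereal\<close> because \<^const>\<open>limsup\<close> needs a complete linear order; on a bounded
  space all values are finite.\<close>

definition besicovitch_along ::
    "('a::metric_space \<Rightarrow> 'a) \<Rightarrow> (nat \<Rightarrow> nat) \<Rightarrow> 'a \<Rightarrow> 'a \<Rightarrow> ereal" where
  "besicovitch_along T n x x' = limsup (\<lambda>k. ereal (orbit_dist_avg T x x' (n k)))"

definition besicovitch :: "('a::metric_space \<Rightarrow> 'a) \<Rightarrow> 'a \<Rightarrow> 'a \<Rightarrow> ereal" where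
  "besicovitch T = besicovitch_along T (\<lambda>k. k)"

definition joinings ::
    "('a::topological_space \<Rightarrow> 'a) \<Rightarrow> 'a measure \<Rightarrow> 'a measure \<Rightarrow> ('a \<times> 'a) measure set" where
  "joinings T \<mu> \<nu> = {\<kappa> \<in> invariant_measures (map_prod T T).
     distr \<kappa> borel fst = \<mu> \<and> distr \<kappa> borel snd = \<nu>}"

definition rho_bar ::
    "('a::metric_space \<Rightarrow> 'a) \<Rightarrow> 'a measure \<Rightarrow> 'a measure \<Rightarrow> real" where
  "rho_bar T \<mu> \<nu> = (INF \<kappa>\<in>joinings T \<mu> \<nu>. \<integral>z. dist (fst z) (snd z) \<partial>\<kappa>)"

end

theory Submission
  imports Defs
begin

text \<open>
  Everything rests on a dictionary between pairs of points and joinings. Fix points \<open>x\<close>, \<open>y\<close> that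
  are quasi-generic for \<open>\<mu>\<close>, \<open>\<nu>\<close> along \<open>n\<close>. Every weak limit point of the empirical measures of
  \<open>(x, y)\<close> under \<open>T \<times> T\<close> is a joining of \<open>\<mu>\<close> and \<open>\<nu>\<close>, and its integral of the metric is a limit point
  of the averaged orbit distances. Hence the lower limit of these averages is at least
  \<open>rho_bar T \<mu> \<nu>\<close> (\<open>rho_bar_le_of_frequently\<close>).

  \<^bold>\<open>From points to measures.\<close> Given a sequence of points \<open>ys m\<close> converging to \<open>y\<close> in the Besicovitch
  pseudometric, let \<open>\<mu>\<close> be any weak limit point of the empirical measures of \<open>y\<close>. Averages of a
  continuous function along two orbits differ little when the averaged orbit distance is small, so
  \<open>M m\<close> converges weakly to \<open>\<mu>\<close>; by the same estimate \<open>y\<close> is quasi-generic for \<open>\<mu>\<close>, and the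
  dictionary bounds \<open>rho_bar T (M m) \<mu>\<close> by the Besicovitch distance of \<open>y\<close> and \<open>ys m\<close>
  (\<open>besicovitch_limit_rho_bar\<close>, \<open>besicovitch_limit_quasi_generic\<close>).

  \<^bold>\<open>Ergodicity of the limit.\<close> In a joining of an ergodic \<open>M m\<close> with \<open>\<mu>\<close>, a function of the first
  coordinate is uncorrelated with every invariant set \<open>A\<close> of the second coordinate, because its
  Birkhoff averages converge to a constant. When the joinings concentrate near the diagonal this
  becomes \<open>\<integral>\<^sub>A f d\<mu> = \<mu>(A) \<integral> f d\<mu>\<close> for all continuous \<open>f\<close>, which forces \<open>\<mu>(A) \<in> {0, 1}\<close>
  (\<open>rho_bar_limit_ergodic\<close>).

  \<^bold>\<open>From measures to points.\<close> Take an optimal joining \<open>\<kappa>\<close> of \<open>M m\<close> and \<open>\<mu>\<close>. It may fail to be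
  ergodic, but both coordinates of \<open>\<kappa>\<close>-almost every pair are generic, since \<open>M m\<close> and \<open>\<mu>\<close> are
  ergodic. By the dictionary, the averaged distances
  along such a pair have lower limit at least \<open>rho_bar T (M m) \<mu>\<close>, and this number is exactly the
  \<open>\<kappa>\<close>-integral of the metric. Averages whose lower limit is almost everywhere at least the integral
  must converge to it (\<open>birkhoff_of_lower_bound\<close>). So \<open>\<kappa>\<close>-almost every pair realises the distance, and
  it remains to choose the pairs for all \<open>m\<close> with a common second coordinate. This is possible because
  \<open>\<mu>\<close>-almost every point is the second coordinate of a good pair, for each \<open>m\<close>
  (\<open>AE_optimal_generic\<close>, \<open>optimal_generic_points\<close>).

  The tools are the Riesz representation theorem on a compact metric space, weak compactness along a
  filter (\<open>normalized_functionals_cluster\<close>), and the maximal ergodic theorem, from which the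
  pointwise statements are derived.
\<close>

section \<open>Riesz representation on compact metric spaces\<close>

locale normalized_functional =
  fixes L :: "('a::metric_space \<Rightarrow> real) \<Rightarrow> real"
  assumes add: "continuous_on UNIV f \<Longrightarrow> continuous_on UNIV g \<Longrightarrow> L (\<lambda>x. f x + g x) = L f + L g"
    and cmult: "continuous_on UNIV f \<Longrightarrow> L (\<lambda>x. c * f x) = c * L f"
    and nonneg: "continuous_on UNIV f \<Longrightarrow> (\<And>x. 0 \<le> f x) \<Longrightarrow> 0 \<le> L f"
    and one: "L (\<lambda>x. 1) = 1"
begin

lemma zero: "L (\<lambda>x. 0) = 0"
  using cmult[of "\<lambda>x. 1" 0] by simp

lemma const: "L (\<lambda>x. c) = c"
  using cmult[of "\<lambda>x. 1" c] by (simp add: one)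

lemma diff: "continuous_on UNIV f \<Longrightarrow> continuous_on UNIV g \<Longrightarrow> L (\<lambda>x. f x - g x) = L f - L g"
  using add[of f "\<lambda>x. (-1) * g x"] cmult[of g "-1"] by (simp add: continuous_intros)

lemma mono:
  "continuous_on UNIV f \<Longrightarrow> continuous_on UNIV g \<Longrightarrow> (\<And>x. f x \<le> g x) \<Longrightarrow> L f \<le> L g"
  using nonneg[of "\<lambda>x. g x - f x"] diff[of g f] by (simp add: continuous_intros)

lemma sum:
  fixes N :: nat
  assumes "\<And>i. continuous_on UNIV (f i)"
  shows "L (\<lambda>x. \<Sum>i<N. f i x) = (\<Sum>i<N. L (f i))"
  using assms by (induction N) (simp_all add: zero add continuous_intros)

text \<open>
  A Daniell-style outer measure: sets are covered by countable sums of nonnegative continuous functions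
  instead of by open sets. Countable subadditivity is then a rearrangement of a double series, and
  splitting a cover means multiplying its members by a continuous function and its complement.
\<close>

definition covers :: "(nat \<Rightarrow> 'a \<Rightarrow> real) \<Rightarrow> 'a set \<Rightarrow> bool" where
  "covers f A \<longleftrightarrow> (\<forall>i. continuous_on UNIV (f i) \<and> (\<forall>x. 0 \<le> f i x)) \<and>
     (\<forall>x\<in>A. 1 \<le> (\<Sum>i. ennreal (f i x)))"

definition outer :: "'a set \<Rightarrow> ennreal" where
  "outer A = (INF f\<in>{f. covers f A}. \<Sum>i. ennreal (L (f i)))"

lemma outer_le: "covers f A \<Longrightarrow> outer A \<le> (\<Sum>i. ennreal (L (f i)))"
  unfolding outer_def by (rule INF_lower) simp

lemma outer_le_double_cover:
  assumes "\<And>i j. continuous_on UNIV (f i j)" "\<And>i j x. 0 \<le> f i j x"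
    and "\<And>x. x \<in> A \<Longrightarrow> 1 \<le> (\<Sum>i. \<Sum>j. ennreal (f i j x))"
  shows "outer A \<le> (\<Sum>i. \<Sum>j. ennreal (L (f i j)))"
proof -
  define h where "h = (\<lambda>k. case prod_decode k of (i, j) \<Rightarrow> f i j)"
  have h: "h = (\<lambda>k. (\<lambda>p. f (fst p) (snd p)) (prod_decode k))"
    by (auto simp: h_def split_def)
  have "(\<Sum>k. ennreal (h k x)) = (\<Sum>i. \<Sum>j. ennreal (f i j x))" for x
    unfolding h by (rule suminf_ennreal_2dimen[where f = "\<lambda>p. ennreal (f (fst p) (snd p) x)"]) simp
  then have "covers h A"
    using assms by (simp add: covers_def) (simp add: h)
  then have "outer A \<le> (\<Sum>k. ennreal (L (h k)))"
    by (rule outer_le)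
  also have "\<dots> = (\<Sum>i. \<Sum>j. ennreal (L (f i j)))"
    unfolding h by (rule suminf_ennreal_2dimen[where f = "\<lambda>p. ennreal (L (f (fst p) (snd p)))"]) simp
  finally show ?thesis .
qed

lemma outer_le_single_function:
  assumes "continuous_on UNIV f" "\<And>x. 0 \<le> f x" "\<And>x. x \<in> A \<Longrightarrow> 1 \<le> f x"
  shows "outer A \<le> ennreal (L f)"
proof -
  define h where "h = (\<lambda>i::nat. if i = 0 then f else (\<lambda>x. 0))"
  have "(\<Sum>i. ennreal (h i x)) = ennreal (f x)" for x
    by (subst suminf_finite[of "{0}"]) (auto simp: h_def)
  moreover have "(\<Sum>i. ennreal (L (h i))) = ennreal (L f)"
    by (subst suminf_finite[of "{0}"]) (auto simp: h_def zero)
  moreover have "1 \<le> ennreal (f x)" if "x \<in> A" for x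
    using assms(3)[OF that] by simp
  moreover have "continuous_on UNIV (h i)" "0 \<le> h i x" for i x
    using assms(1,2) by (simp_all add: h_def)
  ultimately show ?thesis
    using outer_le[of h A] by (simp add: covers_def)
qed

lemma outer_measure_space_outer: "outer_measure_space (Pow UNIV) outer"
  unfolding outer_measure_space_def
proof (intro conjI)
  show "positive (Pow UNIV) outer"
    using outer_le_single_function[of "\<lambda>x. 0" "{}"] by (simp add: positive_def zero)
  show "increasing (Pow UNIV) outer"
    unfolding increasing_def outer_def
    by (auto intro!: INF_superset_mono simp: covers_def)
  show "countably_subadditive (Pow UNIV) outer"
    unfolding countably_subadditive_def
  proof (intro allI impI, rule ennreal_le_epsilon)
    fix A :: "nat \<Rightarrow> 'a set" and e :: real
    assume "0 < e" "(\<Sum>n. outer (A n)) < top"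
    then have *: "outer (A n) < outer (A n) + e * (1/2)^Suc n" for n
      by (auto simp add: less_top dest!: ennreal_suminf_lessD)
    have "\<exists>f. covers f (A n) \<and> (\<Sum>i. ennreal (L (f i))) < outer (A n) + e * (1/2)^Suc n" for n
      using *[of n] unfolding outer_def INF_less_iff by auto
    then obtain f where f: "\<And>n. covers (f n) (A n)"
      and le: "\<And>n. (\<Sum>i. ennreal (L (f n i))) < outer (A n) + e * (1/2)^Suc n"
      by metis
    have "1 \<le> (\<Sum>n. \<Sum>i. ennreal (f n i x))" if x: "x \<in> A m" for x m
    proof -
      have "1 \<le> (\<Sum>i. ennreal (f m i x))"
        using f[of m] x by (auto simp: covers_def)
      also have "\<dots> \<le> (\<Sum>n. \<Sum>i. ennreal (f n i x))"
        using sum_le_suminf[of "\<lambda>n. \<Sum>i. ennreal (f n i x)" "{m}"] by simp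
      finally show ?thesis .
    qed
    then have "outer (\<Union>i. A i) \<le> (\<Sum>n. \<Sum>i. ennreal (L (f n i)))"
      using f by (intro outer_le_double_cover) (auto simp: covers_def)
    also have "\<dots> \<le> (\<Sum>n. outer (A n) + e * (1/2)^Suc n)"
      by (intro suminf_le allI less_imp_le le) auto
    also have "\<dots> = (\<Sum>n. outer (A n)) + (\<Sum>n. ennreal e * ennreal ((1/2) ^ Suc n))"
      using \<open>0 < e\<close> by (subst suminf_add[symmetric])
                       (auto simp del: ennreal_suminf_cmult simp add: ennreal_mult[symmetric])
    also have "\<dots> = (\<Sum>n. outer (A n)) + e"
      unfolding ennreal_suminf_cmult
      by (subst suminf_ennreal_eq[OF zero_le_power power_half_series]) auto
    finally show "outer (\<Union>i. A i) \<le> (\<Sum>n. outer (A n)) + ennreal e" .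
  qed
qed

text \<open>
  Caratheodory measurability of a closed set \<open>F\<close>. Let \<open>h N\<close> decrease to the indicator of \<open>F\<close>. A cover
  \<open>f\<close> of \<open>E\<close> splits into \<open>h N * f i\<close>, which covers \<open>E \<inter> F\<close> for every \<open>N\<close>, and the telescoping
  pieces \<open>(h n - h (Suc n)) * f i\<close>, which together cover \<open>E - F\<close>. The first \<open>N\<close> layers of the
  latter and \<open>h N * f\<close> add up to \<open>f\<close>, so no cost is lost.
\<close>

lemma closed_in_lambda_system:
  assumes F: "closed F"
  shows "F \<in> lambda_system UNIV (Pow UNIV) outer"
proof (cases "F = {}")
  case True
  then show ?thesis
    using algebra.lambda_system_empty[OF algebra_Pow, of UNIV outer] outer_measure_space_outer
    by (simp add: outer_measure_space_def)
next
  case False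
  define h where "h = (\<lambda>(n::nat) x. max 0 (1 - real n * infdist x F))"
  have h_cont: "continuous_on UNIV (h n)" for n
    unfolding h_def by (intro continuous_intros)
  have h0: "h 0 x = 1" for x
    by (simp add: h_def)
  have h_nonneg: "0 \<le> h n x" for n x
    by (simp add: h_def)
  have h_le1: "h n x \<le> 1" for n x
    by (simp add: h_def infdist_nonneg)
  have h_F: "h n x = 1" if "x \<in> F" for n x
    using that by (simp add: h_def)
  have h_dec: "h (Suc n) x \<le> h n x" for n x
    using mult_right_mono[OF _ infdist_nonneg, of "real n" "real (Suc n)" x F]
    by (auto simp: h_def intro!: max.mono)
  have h_lim: "(\<lambda>n. h n x) \<longlonglongrightarrow> 0" if "x \<notin> F" for x
  proof -
    have pos: "infdist x F > 0"
      using that F False in_closed_iff_infdist_zero[of F x] infdist_nonneg[of x F] by force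
    obtain n0 :: nat where n0: "1 / infdist x F < n0"
      using reals_Archimedean2 by blast
    have "h n x = 0" if "n \<ge> n0" for n
    proof -
      have "1 \<le> real n0 * infdist x F"
        using n0 pos by (simp add: field_simps)
      also have "\<dots> \<le> real n * infdist x F"
        using that by (intro mult_right_mono) (auto simp: infdist_nonneg)
      finally show ?thesis by (simp add: h_def)
    qed
    then show ?thesis
      by (intro tendsto_eventually) (auto simp: eventually_sequentially)
  qed
  have key: "outer (E \<inter> F) + outer (E - F) \<le> outer E" for E
    unfolding outer_def[of E]
  proof (rule INF_greatest)
    fix f assume "f \<in> {f. covers f E}"
    then have f_cont: "continuous_on UNIV (f i)" and f_nonneg: "0 \<le> f i x"
      and f_cover: "y \<in> E \<Longrightarrow> 1 \<le> (\<Sum>i. ennreal (f i y))" for i x y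
      by (auto simp: covers_def)
    define d where "d = (\<lambda>(n::nat) i x. (h n x - h (Suc n) x) * f i x)"
    have d_cont: "continuous_on UNIV (d n i)" for n i
      unfolding d_def by (intro continuous_intros h_cont f_cont)
    have d_nonneg: "0 \<le> d n i x" for n i x
      using h_dec[of n x] f_nonneg by (simp add: d_def)
    have Ld: "0 \<le> L (d n i)" for n i
      by (rule nonneg[OF d_cont d_nonneg])
    have tele: "(\<Sum>n<N. d n i x) = (1 - h N x) * f i x" for N i x
      by (induction N) (auto simp: d_def h0 algebra_simps)
    have "outer (E - F) \<le> (\<Sum>n. \<Sum>i. ennreal (L (d n i)))"
    proof (rule outer_le_double_cover[OF d_cont d_nonneg])
      fix x assume x: "x \<in> E - F"
      have "(\<lambda>n. h n x - h (Suc n) x) sums (h 0 x - 0)"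
        using h_lim[of x] x by (intro telescope_sums') auto
      then have "(\<Sum>n. ennreal (h n x - h (Suc n) x)) = 1"
        using h_dec[of _ x] by (subst suminf_ennreal_eq) (auto simp: h0)
      moreover have "(\<Sum>n. \<Sum>i. ennreal (d n i x))
        = (\<Sum>n. ennreal (h n x - h (Suc n) x)) * (\<Sum>i. ennreal (f i x))"
        using h_dec[of _ x] f_nonneg by (simp add: d_def ennreal_mult)
      ultimately show "1 \<le> (\<Sum>n. \<Sum>i. ennreal (d n i x))"
        using f_cover[of x] x by simp
    qed
    moreover have "(\<Sum>n. \<Sum>i. ennreal (L (d n i))) + outer (E \<inter> F) \<le> (\<Sum>i. ennreal (L (f i)))"
    proof (rule ennreal_suminf_bound_add)
      fix N
      have hf_cont: "continuous_on UNIV (\<lambda>x. h N x * f i x)"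
        "continuous_on UNIV (\<lambda>x. (1 - h N x) * f i x)" for i
        by (intro continuous_intros h_cont f_cont)+
      have "outer (E \<inter> F) \<le> (\<Sum>i. ennreal (L (\<lambda>x. h N x * f i x)))"
        using f_cover by (intro outer_le) (auto simp: covers_def hf_cont h_nonneg f_nonneg h_F)
      moreover have "(\<Sum>n<N. \<Sum>i. ennreal (L (d n i)))
          = (\<Sum>i. ennreal (L (\<lambda>x. (1 - h N x) * f i x)))"
      proof -
        have "(\<Sum>n<N. \<Sum>i. ennreal (L (d n i))) = (\<Sum>i. \<Sum>n<N. ennreal (L (d n i)))"
          by (rule suminf_sum[symmetric]) simp
        also have "\<dots> = (\<Sum>i. ennreal (L (\<lambda>x. (1 - h N x) * f i x)))"
        proof (rule suminf_cong)
          fix i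
          have "L (\<lambda>x. \<Sum>n<N. d n i x) = (\<Sum>n<N. L (d n i))"
            by (rule sum[OF d_cont])
          then show "(\<Sum>n<N. ennreal (L (d n i))) = ennreal (L (\<lambda>x. (1 - h N x) * f i x))"
            using Ld by (simp add: tele sum_ennreal)
        qed
        finally show ?thesis .
      qed
      moreover have "(\<Sum>i. ennreal (L (\<lambda>x. (1 - h N x) * f i x)))
         + (\<Sum>i. ennreal (L (\<lambda>x. h N x * f i x))) = (\<Sum>i. ennreal (L (f i)))"
      proof -
        have "0 \<le> L (\<lambda>x. (1 - h N x) * f i x)" "0 \<le> L (\<lambda>x. h N x * f i x)" for i
          by (intro nonneg hf_cont; simp add: h_nonneg f_nonneg h_le1)+
        moreover have "L (\<lambda>x. (1 - h N x) * f i x) + L (\<lambda>x. h N x * f i x) = L (f i)" for i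
          using add[OF hf_cont(2)[of i] hf_cont(1)[of i]] by (simp add: algebra_simps)
        ultimately have "ennreal (L (\<lambda>x. (1 - h N x) * f i x)) + ennreal (L (\<lambda>x. h N x * f i x))
            = ennreal (L (f i))" for i
          by (metis ennreal_plus)
        then show ?thesis
          by (subst suminf_add) auto
      qed
      ultimately show "(\<Sum>n<N. \<Sum>i. ennreal (L (d n i))) + outer (E \<inter> F) \<le> (\<Sum>i. ennreal (L (f i)))"
        using add_left_mono[of "outer (E \<inter> F)" "\<Sum>i. ennreal (L (\<lambda>x. h N x * f i x))"
            "\<Sum>n<N. \<Sum>i. ennreal (L (d n i))"]
        by argo
    qed
    ultimately show "outer (E \<inter> F) + outer (E - F) \<le> (\<Sum>i. ennreal (L (f i)))"
      by (subst add.commute) (rule order_trans[OF add_right_mono])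
  qed
  have "outer E \<le> outer (E \<inter> F) + outer (E - F)" for E
  proof -
    have "range (binaryset (E \<inter> F) (E - F)) \<subseteq> Pow UNIV" by simp
    moreover have "disjoint_family (binaryset (E \<inter> F) (E - F))"
      by (auto simp: disjoint_family_on_def binaryset_def)
    ultimately have "outer (\<Union>i. binaryset (E \<inter> F) (E - F) i) \<le> (\<Sum>i. outer (binaryset (E \<inter> F) (E - F) i))"
      using outer_measure_space_outer unfolding outer_measure_space_def countably_subadditive_def
      by blast
    moreover have "outer {} = 0"
      using outer_measure_space_outer by (simp add: outer_measure_space_def positive_def)
    moreover have "(E \<inter> F) \<union> (E - F) = E" by auto
    ultimately show ?thesis
      by (simp add: UN_binaryset_eq suminf_binaryset_eq)
  qed
  with key show ?thesis
    unfolding algebra.lambda_system_eq[OF algebra_Pow] by (auto intro: antisym)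
qed

lemma measure_space_outer: "measure_space UNIV (sets borel) outer"
proof -
  have ms: "measure_space UNIV (lambda_system UNIV (Pow UNIV) outer) outer"
    using sigma_algebra.caratheodory_lemma[OF sigma_algebra_Pow outer_measure_space_outer] .
  then have sa: "sigma_algebra UNIV (lambda_system UNIV (Pow UNIV) outer)"
    by (simp add: measure_space_def)
  have "U \<in> lambda_system UNIV (Pow UNIV) outer" if "open U" for U
    using algebra.lambda_system_Compl[OF algebra_Pow closed_in_lambda_system, of "- U"] that
    by (simp add: closed_Compl Compl_eq_Diff_UNIV[symmetric])
  then have "sets borel \<subseteq> lambda_system UNIV (Pow UNIV) outer"
    using sigma_algebra.sigma_sets_subset[OF sa, of "{S. open S}"] by (auto simp: sets_borel)
  moreover have "sigma_algebra UNIV (sets (borel::'a measure))"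
    using sets.sigma_algebra_axioms[of "borel::'a measure"] by simp
  ultimately show ?thesis
    by (intro measure_down[OF ms])
qed

definition rep_measure :: "'a measure" where
  "rep_measure = measure_of UNIV (sets borel) outer"

lemma sets_rep_measure [simp]: "sets rep_measure = sets borel"
  using sets.sigma_sets_eq[of "borel :: 'a measure"]
  by (simp add: rep_measure_def sets_measure_of_conv)

lemma space_rep_measure [simp]: "space rep_measure = UNIV"
  by (simp add: rep_measure_def space_measure_of_conv)

lemma emeasure_rep_measure: "A \<in> sets borel \<Longrightarrow> emeasure rep_measure A = outer A"
  unfolding rep_measure_def
  by (rule emeasure_measure_of_sigma) (use measure_space_outer in \<open>auto simp: measure_space_def\<close>)

text \<open>
  Compactness enters here, as in the theorem of Dini: if a series of nonnegative continuous functions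
  is at least \<open>1\<close> everywhere, then some partial sum exceeds \<open>1 - e\<close> everywhere.
\<close>

lemma outer_UNIV_ge:
  assumes "compact (UNIV :: 'a set)"
  shows "1 \<le> outer UNIV"
  unfolding outer_def
proof (rule INF_greatest, rule ennreal_le_epsilon)
  fix f and e :: real assume "f \<in> {f. covers f UNIV}" and e: "0 < e"
  then have f_cont: "continuous_on UNIV (f i)" and f_nonneg: "0 \<le> f i x"
    and f_cover: "1 \<le> (\<Sum>i. ennreal (f i y))" for i x y
    by (auto simp: covers_def)
  define U where "U = (\<lambda>N::nat. {x. 1 - e < (\<Sum>i<N. f i x)})"
  have "open (U N)" for N
    unfolding U_def by (intro open_Collect_less continuous_intros f_cont)
  moreover have "UNIV \<subseteq> (\<Union>N. U N)"
  proof safe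
    fix x
    have "ennreal (1 - e) < 1" using e by (simp add: ennreal_less_one_iff)
    also have "1 \<le> (SUP N. \<Sum>i<N. ennreal (f i x))"
      using f_cover[of x] by (simp add: suminf_eq_SUP)
    finally obtain N where N: "ennreal (1 - e) < (\<Sum>i<N. ennreal (f i x))"
      by (auto simp: less_SUP_iff)
    then have "ennreal (1 - e) < ennreal (\<Sum>i<N. f i x)"
      by (simp add: f_nonneg)
    then have "1 - e < (\<Sum>i<N. f i x)"
      by (meson ennreal_leI not_less)
    then show "x \<in> (\<Union>N. U N)" by (auto simp: U_def)
  qed
  ultimately obtain C where C: "finite C" "UNIV \<subseteq> (\<Union>N\<in>C. U N)"
    using compactE_image[OF assms, of UNIV U] by auto
  define N where "N = Max (insert 0 C)"
  have "1 - e \<le> (\<Sum>i<N. f i x)" for x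
  proof -
    obtain k where k: "k \<in> C" "x \<in> U k" using C by blast
    then have "k \<le> N" using C by (auto simp: N_def)
    then have "(\<Sum>i<k. f i x) \<le> (\<Sum>i<N. f i x)"
      by (intro sum_mono2) (auto simp: f_nonneg)
    with k show ?thesis by (auto simp: U_def)
  qed
  then have "L (\<lambda>x. 1 - e) \<le> L (\<lambda>x. \<Sum>i<N. f i x)"
    by (intro mono continuous_intros f_cont)
  then have "1 \<le> (\<Sum>i<N. L (f i)) + e"
    by (simp add: const sum f_cont)
  moreover have "0 \<le> (\<Sum>i<N. L (f i))"
    by (intro sum_nonneg nonneg f_cont f_nonneg)
  ultimately have "1 \<le> ennreal (\<Sum>i<N. L (f i)) + ennreal e"
    using e ennreal_leI[of 1 "(\<Sum>i<N. L (f i)) + e"] by simp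
  also have "ennreal (\<Sum>i<N. L (f i)) = (\<Sum>i<N. ennreal (L (f i)))"
    by (simp add: nonneg f_cont f_nonneg)
  also have "\<dots> \<le> (\<Sum>i. ennreal (L (f i)))"
    by (intro sum_le_suminf) auto
  finally show "1 \<le> (\<Sum>i. ennreal (L (f i))) + ennreal e"
    by (simp add: add_right_mono)
qed

lemma prob_space_rep_measure:
  assumes "compact (UNIV :: 'a set)"
  shows "prob_space rep_measure"
proof
  have "outer UNIV \<le> ennreal (L (\<lambda>x. 1))"
    by (rule outer_le_single_function) auto
  then show "emeasure rep_measure (space rep_measure) = 1"
    using outer_UNIV_ge[OF assms] by (simp add: emeasure_rep_measure one antisym)
qed

text \<open>
  Cut \<open>n * f\<close> into the unit slices \<open>min 1 (max 0 (n * f - k))\<close>. The slice with index \<open>k\<close> is \<open>1\<close> on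
  the level set \<open>{k + 1 \<le> n * f}\<close>, so that its functional value bounds the measure of this set, and
  counting level sets approximates \<open>n * f\<close> with an error of at most \<open>1\<close>. One inequality suffices:
  applied to \<open>1 - f\<close> it yields the other.
\<close>

lemma integral_rep_measure_le:
  assumes X: "compact (UNIV :: 'a set)" and f: "continuous_on UNIV f" and f01: "\<And>x. 0 \<le> f x" "\<And>x. f x \<le> 1"
  shows "(\<integral>x. f x \<partial>rep_measure) \<le> L f"
proof -
  interpret prob_space rep_measure by (rule prob_space_rep_measure[OF X])
  define I where "I = (\<integral>x. f x \<partial>rep_measure)"
  have f_meas: "f \<in> borel_measurable rep_measure"
    using borel_measurable_continuous_onI[OF f] by (simp cong: measurable_cong_sets)
  have f_int: "integrable rep_measure f"
    by (rule integrable_const_bound[of _ 1]) (use f01 f_meas in auto)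
  have bound: "n * I \<le> 1 + n * L f" for n :: nat
  proof -
    define s where "s = (\<lambda>(k::nat) x. min 1 (max 0 (real n * f x - real k)))"
    define A where "A = (\<lambda>k::nat. {x. real k + 1 \<le> real n * f x})"
    have s_cont: "continuous_on UNIV (s k)" for k
      unfolding s_def by (intro continuous_intros f)
    have "closed (A k)" for k
      unfolding A_def by (intro closed_Collect_le continuous_intros f)
    then have A: "A k \<in> sets rep_measure" for k
      by simp
    have int_A: "integrable rep_measure (indicator (A k) :: 'a \<Rightarrow> real)" for k
      by (rule integrable_real_indicator[OF A]) (simp add: less_top[symmetric])
    have step_up: "t \<le> 1 + (\<Sum>k<m. if real k + 1 \<le> t then 1 else 0)" if "t \<le> real m" for t m
      using that
    proof (induction m)
      case (Suc m)
      show ?case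
      proof (cases "t \<le> real m")
        case True
        with Suc.IH show ?thesis by simp
      next
        case False
        then have "(\<Sum>k<m. if real k + 1 \<le> t then 1 else 0) = (\<Sum>k<m. 1::real)"
          by (intro sum.cong) auto
        then show ?thesis using Suc.prems by auto
      qed
    qed simp
    have slices: "(\<Sum>k<m. min 1 (max 0 (t - real k))) = min t (real m)" if "0 \<le> t" for t m
      using that by (induction m) auto
    have "n * I = (\<integral>x. n * f x \<partial>rep_measure)"
      by (simp add: I_def)
    also have "\<dots> \<le> (\<integral>x. 1 + (\<Sum>k<n. indicator (A k) x) \<partial>rep_measure)"
    proof (rule integral_mono)
      show "integrable rep_measure (\<lambda>x. real n * f x)" using f_int by simp
      show "integrable rep_measure (\<lambda>x. 1 + (\<Sum>k<n. indicator (A k) x) :: real)"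
        using int_A by (auto intro!: Bochner_Integration.integrable_add Bochner_Integration.integrable_sum)
      show "n * f x \<le> 1 + (\<Sum>k<n. indicator (A k) x)" for x
        using step_up[of "n * f x" n] f01(2)[of x]
        by (simp add: A_def indicator_def mult_left_le of_bool_def)
    qed
    also have "\<dots> = 1 + (\<Sum>k<n. measure rep_measure (A k))"
      using A int_A by (subst Bochner_Integration.integral_add)
        (auto simp: prob_space[simplified] Bochner_Integration.integral_sum)
    also have "(\<Sum>k<n. measure rep_measure (A k)) \<le> (\<Sum>k<n. L (s k))"
    proof (rule sum_mono)
      fix k
      have "emeasure rep_measure (A k) \<le> ennreal (L (s k))"
        using A[of k] s_cont[of k] by (simp add: emeasure_rep_measure)
          (auto intro!: outer_le_single_function simp: s_def A_def)
      then show "measure rep_measure (A k) \<le> L (s k)"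
        using nonneg[OF s_cont[of k]] by (simp add: emeasure_eq_measure s_def)
    qed
    also have "(\<Sum>k<n. L (s k)) = L (\<lambda>x. \<Sum>k<n. s k x)"
      by (rule sum[OF s_cont, symmetric])
    also have "(\<lambda>x. \<Sum>k<n. s k x) = (\<lambda>x. n * f x)"
      using slices f01 by (auto simp: s_def mult_left_le min_absorb1)
    finally show ?thesis by (simp add: cmult f)
  qed
  have "I \<le> L f"
  proof (rule ccontr)
    assume "\<not> I \<le> L f"
    then have "0 < I - L f" by simp
    then obtain n :: nat where "1 < real n * (I - L f)"
      using reals_Archimedean3 by blast
    with bound[of n] show False by (simp add: algebra_simps)
  qed
  then show ?thesis by (simp add: I_def)
qed

end

theorem riesz_representation:
  fixes L :: "('a::metric_space \<Rightarrow> real) \<Rightarrow> real"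
  assumes X: "compact (UNIV :: 'a set)" and L: "normalized_functional L"
  shows "\<exists>\<mu>. prob_space \<mu> \<and> sets \<mu> = sets borel \<and> (\<forall>f. continuous_on UNIV f \<longrightarrow> (\<integral>x. f x \<partial>\<mu>) = L f)"
proof -
  interpret normalized_functional L by fact
  interpret prob_space rep_measure by (rule prob_space_rep_measure[OF X])
  have eq: "(\<integral>x. f x \<partial>rep_measure) = L f" if f: "continuous_on UNIV f" for f
  proof -
    have "bounded (range f)"
      using compact_continuous_image[OF f X] compact_imp_bounded by blast
    then obtain B where B: "0 < B" "\<And>x. \<bar>f x\<bar> \<le> B"
      unfolding bounded_pos by auto
    \<comment> \<open>Rescaling to values between 0 and 1; g and 1 - g give the two inequalities.\<close>
    define g where "g = (\<lambda>x. (1 + f x / B) / 2)"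
    have g: "continuous_on UNIV g"
      unfolding g_def using B by (intro continuous_intros f) auto
    have g01: "0 \<le> g x" "g x \<le> 1" for x
      using B(1) B(2)[of x] by (auto simp: g_def field_simps abs_le_iff)
    have int: "integrable rep_measure g"
      using g01 borel_measurable_continuous_onI[OF g]
      by (intro integrable_const_bound[of _ 1]) (auto cong: measurable_cong_sets)
    have "(\<integral>x. 1 - g x \<partial>rep_measure) \<le> L (\<lambda>x. 1 - g x)"
      using g01 by (intro integral_rep_measure_le[OF X] continuous_intros g) auto
    then have "(\<integral>x. g x \<partial>rep_measure) \<ge> L g"
      using int by (simp add: diff g one prob_space[simplified])
    moreover have "(\<integral>x. g x \<partial>rep_measure) \<le> L g"
      using g01 by (intro integral_rep_measure_le[OF X] g) auto
    ultimately have eq_g: "(\<integral>x. g x \<partial>rep_measure) = L g" by simp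
    have f_g: "f = (\<lambda>x. 2 * B * g x - B)"
      using B by (auto simp: g_def field_simps)
    show ?thesis
      unfolding f_g using int g
      by (simp add: diff cmult const eq_g prob_space[simplified] continuous_intros)
  qed
  show ?thesis
    using eq prob_space_axioms sets_rep_measure by blast
qed

section \<open>Weak limits of measures\<close>

lemma bounded_continuous:
  fixes f :: "'a::metric_space \<Rightarrow> real"
  assumes "compact (UNIV :: 'a set)" "continuous_on UNIV f"
  obtains B where "0 < B" "\<And>x. \<bar>f x\<bar> \<le> B"
proof -
  have "bounded (range f)"
    using compact_continuous_image[OF assms(2,1)] compact_imp_bounded by blast
  then show ?thesis
    using that unfolding bounded_pos by auto
qed

lemma finite_borel_integrable:
  fixes f :: "'a::topological_space \<Rightarrow> real"
  assumes "finite_measure \<mu>" "sets \<mu> = sets borel" "f \<in> borel_measurable borel" "\<And>x. \<bar>f x\<bar> \<le> B"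
  shows "integrable \<mu> f"
proof -
  interpret finite_measure \<mu> by fact
  show ?thesis
    using assms by (intro integrable_const_bound[of _ B]) (auto cong: measurable_cong_sets)
qed

lemma continuous_integrable:
  fixes f :: "'a::metric_space \<Rightarrow> real"
  assumes "compact (UNIV :: 'a set)" "prob_space \<mu>" "sets \<mu> = sets borel" "continuous_on UNIV f"
  shows "integrable \<mu> f"
proof -
  obtain B where "\<And>x. \<bar>f x\<bar> \<le> B"
    using bounded_continuous[OF assms(1,4)] by blast
  then show ?thesis
    by (rule finite_borel_integrable[OF prob_space.axioms(1)[OF assms(2)] assms(3)
          borel_measurable_continuous_onI[OF assms(4)]])
qed

lemma normalized_functional_integral:
  fixes \<mu> :: "'a::metric_space measure"
  assumes X: "compact (UNIV :: 'a set)" and \<mu>: "prob_space \<mu>" "sets \<mu> = sets borel"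
  shows "normalized_functional (\<lambda>f. \<integral>x. f x \<partial>\<mu>)"
proof
  interpret prob_space \<mu> by fact
  note int = continuous_integrable[OF X \<mu>]
  show "(\<integral>x. f x + g x \<partial>\<mu>) = (\<integral>x. f x \<partial>\<mu>) + (\<integral>x. g x \<partial>\<mu>)"
    if "continuous_on UNIV f" "continuous_on UNIV g" for f g :: "'a \<Rightarrow> real"
    using int[OF that(1)] int[OF that(2)] by simp
qed (simp_all add: prob_space.prob_space[OF \<mu>(1)])

text \<open>
  The indicator of a closed set is a decreasing limit of continuous functions, and closed sets form an
  intersection-stable generator.
\<close>

lemma borel_measure_eqI:
  fixes M N :: "'a::metric_space measure"
  assumes M: "finite_measure M" "sets M = sets borel" and N: "finite_measure N" "sets N = sets borel"
    and eq: "\<And>f :: 'a \<Rightarrow> real. continuous_on UNIV f \<Longrightarrow> (\<And>x. 0 \<le> f x) \<Longrightarrow> (\<And>x. f x \<le> 1) \<Longrightarrow> (\<integral>x. f x \<partial>M) = (\<integral>x. f x \<partial>N)"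
  shows "M = N"
proof (rule measure_eqI_generator_eq)
  show "Int_stable (Collect closed :: 'a set set)"
    by (auto simp: Int_stable_def)
  show "sets M = sigma_sets UNIV (Collect closed)" "sets N = sigma_sets UNIV (Collect closed)"
    by (simp_all add: M N borel_eq_closed)
  show "range (\<lambda>i::nat. UNIV :: 'a set) \<subseteq> Collect closed" by auto
  show "emeasure M UNIV \<noteq> \<infinity>"
    using M(1) finite_measure.finite_emeasure_space[of M] sets_eq_imp_space_eq[OF M(2)] by simp
  fix F :: "'a set" assume "F \<in> Collect closed"
  then have F: "closed F" by simp
  show "emeasure M F = emeasure N F"
  proof (cases "F = {}")
    case False
    define h where "h = (\<lambda>(n::nat) x. max 0 (1 - real n * infdist x F))"
    have h_cont: "continuous_on UNIV (h n)" for n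
      unfolding h_def by (intro continuous_intros)
    have h01: "0 \<le> h n x" "h n x \<le> 1" for n x
      by (simp_all add: h_def infdist_nonneg)
    have h_lim: "(\<lambda>n. h n x) \<longlonglongrightarrow> indicator F x" for x
    proof (cases "x \<in> F")
      case True
      then show ?thesis by (simp add: h_def)
    next
      case False
      then have pos: "infdist x F > 0"
        using F \<open>F \<noteq> {}\<close> in_closed_iff_infdist_zero[of F x] infdist_nonneg[of x F] by force
      then have "((\<lambda>n. max 0 (1 - real n * infdist x F)) \<longlongrightarrow> 0) sequentially"
        by real_asymp
      then show ?thesis using False by (simp add: h_def)
    qed
    have lim: "(\<lambda>n. \<integral>x. h n x \<partial>\<mu>) \<longlonglongrightarrow> measure \<mu> F" if \<mu>: "finite_measure \<mu>" "sets \<mu> = sets borel" for \<mu>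
    proof -
      interpret finite_measure \<mu> by fact
      have "(\<lambda>n. \<integral>x. h n x \<partial>\<mu>) \<longlonglongrightarrow> (\<integral>x. indicator F x \<partial>\<mu>)"
      proof (rule integral_dominated_convergence[where w = "\<lambda>x. 1"])
        show "h n \<in> borel_measurable \<mu>" for n
          using borel_measurable_continuous_onI[OF h_cont] by (simp add: measurable_cong_sets[OF \<mu>(2)])
        show "indicator F \<in> borel_measurable \<mu>"
          using F \<mu> by (intro borel_measurable_indicator) simp
      qed (use h_lim h01 in auto)
      then show ?thesis
        using F \<mu> by simp
    qed
    have "(\<integral>x. h n x \<partial>M) = (\<integral>x. h n x \<partial>N)" for n
      by (intro eq h_cont h01)
    then have "measure M F = measure N F"
      using LIMSEQ_unique[OF lim[OF M]] lim[OF N] by simp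
    then show ?thesis
      using M(1) N(1) by (simp add: finite_measure.emeasure_eq_measure)
  qed simp
qed auto

text \<open>
  Weak compactness. The functionals are points of a product of compact intervals, indexed by all
  continuous functions, so by Tychonoff they have a cluster point, which the Riesz theorem represents
  by a measure. The filter \<open>G\<close> plays the part of a subsequence: it serves all continuous functions
  at once, and limits along \<open>sequentially\<close> remain limits along \<open>G\<close>.
\<close>

theorem normalized_functionals_cluster:
  fixes \<Lambda> :: "nat \<Rightarrow> ('a::metric_space \<Rightarrow> real) \<Rightarrow> real"
  assumes X: "compact (UNIV :: 'a set)" and \<Lambda>: "\<forall>\<^sub>F k in sequentially. normalized_functional (\<Lambda> k)"
  obtains G \<mu> where "G \<le> sequentially" "G \<noteq> bot" "prob_space \<mu>" "sets \<mu> = sets borel"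
    "\<And>f. continuous_on UNIV f \<Longrightarrow> ((\<lambda>k. \<Lambda> k f) \<longlongrightarrow> (\<integral>x. f x \<partial>\<mu>)) G"
proof -
  have "\<exists>B. continuous_on UNIV f \<longrightarrow> (\<forall>x. \<bar>f x\<bar> \<le> B)" for f :: "'a \<Rightarrow> real"
    using bounded_continuous[OF X] by metis
  then obtain B where B: "\<And>(f :: 'a \<Rightarrow> real) x. continuous_on UNIV f \<Longrightarrow> \<bar>f x\<bar> \<le> B f"
    by metis
  define \<Phi> where "\<Phi> = (\<lambda>k f. if continuous_on UNIV f then \<Lambda> k f else 0)"
  define K where "K = (\<Pi>\<^sub>E f\<in>UNIV. {- \<bar>B f\<bar>..\<bar>B f\<bar>})"
  have "compactin (product_topology (\<lambda>f. euclidean) UNIV) K"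
    unfolding K_def compactin_PiE by auto
  then have "compact K"
    by (simp add: euclidean_product_topology)
  moreover have "\<forall>\<^sub>F \<phi> in filtermap \<Phi> sequentially. \<phi> \<in> K"
    unfolding eventually_filtermap using \<Lambda>
  proof eventually_elim
    case (elim k)
    interpret normalized_functional "\<Lambda> k" by fact
    have "- \<bar>B f\<bar> \<le> \<Lambda> k f \<and> \<Lambda> k f \<le> \<bar>B f\<bar>" if f: "continuous_on UNIV f" for f
    proof -
      have "f x \<le> B f" "- B f \<le> f x" for x
        using B[OF f, of x] by auto
      then have "\<Lambda> k f \<le> \<Lambda> k (\<lambda>x. B f)" "\<Lambda> k (\<lambda>x. - B f) \<le> \<Lambda> k f"
        using f by (auto intro!: mono)
      then show ?thesis by (simp add: const)
    qed
    then show ?case by (auto simp: K_def \<Phi>_def)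
  qed
  ultimately obtain L where L: "inf (nhds L) (filtermap \<Phi> sequentially) \<noteq> bot"
    unfolding compact_filter by (meson filtermap_bot_iff sequentially_bot)
  define G where "G = inf sequentially (filtercomap \<Phi> (nhds L))"
  have G_le: "G \<le> sequentially" by (simp add: G_def)
  have G_ne: "G \<noteq> bot"
  proof
    assume "G = bot"
    then have "eventually (\<lambda>_. False) G" by simp
    then obtain P Q where P: "eventually P sequentially" and Q: "eventually Q (nhds L)"
      and PQ: "\<And>k. P k \<Longrightarrow> Q (\<Phi> k) \<Longrightarrow> False"
      unfolding G_def eventually_inf eventually_filtercomap by blast
    have "eventually (\<lambda>\<phi>. \<not> Q \<phi>) (filtermap \<Phi> sequentially)"
      unfolding eventually_filtermap using P by (rule eventually_mono) (use PQ in blast)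
    then have "eventually (\<lambda>_. False) (inf (nhds L) (filtermap \<Phi> sequentially))"
      unfolding eventually_inf using Q by blast
    with L show False by (simp add: eventually_False)
  qed
  have \<Phi>_lim: "filterlim \<Phi> (nhds L) G"
    by (rule filterlim_mono[OF filterlim_filtercomap order_refl]) (simp add: G_def)
  have \<Phi>_coord: "((\<lambda>k. \<Phi> k f) \<longlongrightarrow> L f) G" for f
  proof (rule topological_tendstoI)
    fix S assume "open S" "L f \<in> S"
    moreover from \<open>open S\<close> have "open ((\<lambda>\<phi>. \<phi> f) -` S)"
      by (intro open_vimage continuous_on_product_coordinates)
    ultimately show "\<forall>\<^sub>F k in G. \<Phi> k f \<in> S"
      using topological_tendstoD[OF \<Phi>_lim, of "(\<lambda>\<phi>. \<phi> f) -` S"] by simp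
  qed
  have lim: "((\<lambda>k. \<Lambda> k f) \<longlongrightarrow> L f) G" if "continuous_on UNIV f" for f
    using \<Phi>_coord[of f] that by (simp add: \<Phi>_def)
  have ev: "\<forall>\<^sub>F k in G. normalized_functional (\<Lambda> k)"
    using \<Lambda> G_le by (rule filter_leD[rotated])
  have "normalized_functional L"
  proof
    fix f g :: "'a \<Rightarrow> real" and c
    assume f: "continuous_on UNIV f"
    show "L (\<lambda>x. f x + g x) = L f + L g" if g: "continuous_on UNIV g"
    proof (rule tendsto_unique[OF G_ne])
      show "((\<lambda>k. \<Lambda> k (\<lambda>x. f x + g x)) \<longlongrightarrow> L (\<lambda>x. f x + g x)) G"
        by (intro lim continuous_intros f g)
      have "\<forall>\<^sub>F k in G. \<Lambda> k f + \<Lambda> k g = \<Lambda> k (\<lambda>x. f x + g x)"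
        using ev by eventually_elim (simp add: normalized_functional.add f g)
      then show "((\<lambda>k. \<Lambda> k (\<lambda>x. f x + g x)) \<longlongrightarrow> L f + L g) G"
        by (rule Lim_transform_eventually[rotated]) (intro tendsto_intros lim f g)
    qed
    show "L (\<lambda>x. c * f x) = c * L f"
    proof (rule tendsto_unique[OF G_ne])
      show "((\<lambda>k. \<Lambda> k (\<lambda>x. c * f x)) \<longlongrightarrow> L (\<lambda>x. c * f x)) G"
        by (intro lim continuous_intros f)
      have "\<forall>\<^sub>F k in G. c * \<Lambda> k f = \<Lambda> k (\<lambda>x. c * f x)"
        using ev by eventually_elim (simp add: normalized_functional.cmult f)
      then show "((\<lambda>k. \<Lambda> k (\<lambda>x. c * f x)) \<longlongrightarrow> c * L f) G"
        by (rule Lim_transform_eventually[rotated]) (intro tendsto_intros lim f)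
    qed
    show "0 \<le> L f" if "\<And>x. 0 \<le> f x"
    proof (rule tendsto_lowerbound[OF lim[OF f] _ G_ne])
      show "\<forall>\<^sub>F k in G. 0 \<le> \<Lambda> k f"
        using ev by eventually_elim (simp add: normalized_functional.nonneg f that)
    qed
  next
    have "\<forall>\<^sub>F k in G. 1 = \<Lambda> k (\<lambda>x. 1)"
      using ev by eventually_elim (simp add: normalized_functional.one)
    then have "((\<lambda>k. \<Lambda> k (\<lambda>x. 1)) \<longlongrightarrow> 1) G"
      by (rule Lim_transform_eventually[rotated]) simp
    with lim[of "\<lambda>x. 1"] show "L (\<lambda>x. 1) = 1"
      using tendsto_unique[OF G_ne] by simp
  qed
  from riesz_representation[OF X this] show ?thesis
    using that[OF G_le G_ne] lim by metis
qed

section \<open>Birkhoff sums and the maximal ergodic theorem\<close>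

definition birkhoff_sum :: "('a \<Rightarrow> 'a) \<Rightarrow> ('a \<Rightarrow> real) \<Rightarrow> nat \<Rightarrow> 'a \<Rightarrow> real" where
  "birkhoff_sum T g n x = (\<Sum>j<n. g ((T ^^ j) x))"

lemma birkhoff_sum_0 [simp]: "birkhoff_sum T g 0 x = 0"
  by (simp add: birkhoff_sum_def)

lemma birkhoff_sum_Suc: "birkhoff_sum T g (Suc n) x = g x + birkhoff_sum T g n (T x)"
  unfolding birkhoff_sum_def by (subst sum.lessThan_Suc_shift) (simp add: funpow_swap1)

lemma birkhoff_sum_diff_const: "birkhoff_sum T (\<lambda>x. g x - c) n x = birkhoff_sum T g n x - real n * c"
  by (simp add: birkhoff_sum_def sum_subtractf)

lemma birkhoff_sum_minus: "birkhoff_sum T (\<lambda>x. - g x) n x = - birkhoff_sum T g n x"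
  by (simp add: birkhoff_sum_def sum_negf)

lemma funpow_measurable:
  fixes T :: "'a::topological_space \<Rightarrow> 'a"
  assumes "T \<in> borel \<rightarrow>\<^sub>M borel"
  shows "T ^^ j \<in> borel \<rightarrow>\<^sub>M borel"
  using assms by (induction j) (simp_all add: measurable_comp id_def)

lemma birkhoff_sum_measurable:
  assumes "T \<in> borel \<rightarrow>\<^sub>M borel" "g \<in> borel_measurable borel"
  shows "birkhoff_sum T g n \<in> borel_measurable borel"
  unfolding birkhoff_sum_def[abs_def]
  by (intro borel_measurable_sum measurable_compose[OF funpow_measurable[OF assms(1)] assms(2)])

lemma invariant_measuresD:
  assumes "\<mu> \<in> invariant_measures T"
  shows "prob_space \<mu>" "sets \<mu> = sets borel" "space \<mu> = UNIV" "distr \<mu> borel T = \<mu>"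
  using assms sets_eq_imp_space_eq[of \<mu> borel] by (auto simp: invariant_measures_def)

lemma invariant_integral:
  fixes g :: "'a::topological_space \<Rightarrow> real"
  assumes \<mu>: "\<mu> \<in> invariant_measures T" and T: "T \<in> borel \<rightarrow>\<^sub>M borel" and g: "g \<in> borel_measurable borel"
  shows "(\<integral>x. g (T x) \<partial>\<mu>) = (\<integral>x. g x \<partial>\<mu>)"
proof -
  have "T \<in> measurable \<mu> borel"
    using T invariant_measuresD(2)[OF \<mu>] by (simp cong: measurable_cong_sets)
  then have "(\<integral>x. g (T x) \<partial>\<mu>) = (\<integral>x. g x \<partial>distr \<mu> borel T)"
    using g by (simp add: integral_distr)
  then show ?thesis by (simp add: invariant_measuresD[OF \<mu>])
qed

text \<open>
  The maximum of the Birkhoff sums of lengths \<open>0, \<dots>, N\<close>, in the recursive form that the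
  maximal ergodic theorem uses.
\<close>

fun max_birkhoff_sum :: "('a \<Rightarrow> 'a) \<Rightarrow> ('a \<Rightarrow> real) \<Rightarrow> nat \<Rightarrow> 'a \<Rightarrow> real" where
  "max_birkhoff_sum T g 0 x = 0"
| "max_birkhoff_sum T g (Suc N) x = max 0 (g x + max_birkhoff_sum T g N (T x))"

lemma max_birkhoff_sum_nonneg: "0 \<le> max_birkhoff_sum T g N x"
  by (cases N) auto

lemma max_birkhoff_sum_mono: "max_birkhoff_sum T g N x \<le> max_birkhoff_sum T g (Suc N) x"
proof (induction N arbitrary: x)
  case (Suc N)
  from Suc[of "T x"] show ?case by (simp del: max_birkhoff_sum.simps(2) add: max_birkhoff_sum.simps(2)[of _ _ _ x])
qed simp

lemma birkhoff_sum_le_max: "birkhoff_sum T g N x \<le> max_birkhoff_sum T g N x"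
proof (induction N arbitrary: x)
  case (Suc N)
  from Suc[of "T x"] show ?case by (simp add: birkhoff_sum_Suc)
qed simp

lemma max_birkhoff_sum_bounded:
  assumes "\<And>x. \<bar>g x\<bar> \<le> B"
  shows "\<bar>max_birkhoff_sum T g N x\<bar> \<le> real N * B"
proof (induction N arbitrary: x)
  case (Suc N)
  have "0 \<le> B" using assms[of x] by linarith
  then show ?case using Suc[of "T x"] assms[of x] by (auto simp: algebra_simps)
qed simp

lemma max_birkhoff_sum_measurable:
  assumes "T \<in> borel \<rightarrow>\<^sub>M borel" "g \<in> borel_measurable borel"
  shows "max_birkhoff_sum T g N \<in> borel_measurable borel"
proof (induction N)
  case 0
  then show ?case by (simp cong: measurable_cong)
next
  case (Suc N)
  have "(\<lambda>x. max 0 (g x + max_birkhoff_sum T g N (T x))) \<in> borel_measurable borel"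
    using measurable_compose[OF assms(1) Suc] assms(2) by simp
  then show ?case by (simp cong: measurable_cong)
qed

text \<open>
  Garsia's argument. Where the maximum \<open>m N\<close> is positive it equals \<open>g + m (N - 1) \<circ> T\<close>, so there
  \<open>g\<close> dominates \<open>m N - m N \<circ> T\<close>. The integral of this difference over an invariant set vanishes,
  and as \<open>N\<close> grows the sets \<open>{0 < m N}\<close> exhaust \<open>E\<close>.
\<close>

theorem maximal_ergodic:
  fixes T :: "'a::topological_space \<Rightarrow> 'a"
  assumes T: "T \<in> borel \<rightarrow>\<^sub>M borel" and \<mu>: "\<mu> \<in> invariant_measures T"
    and g: "g \<in> borel_measurable borel" and B: "\<And>x. \<bar>g x\<bar> \<le> B"
    and E: "E \<in> sets borel" "T -` E = E" and pos: "\<And>x. x \<in> E \<Longrightarrow> \<exists>n. 0 < birkhoff_sum T g n x"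
  shows "0 \<le> (\<integral>x. indicator E x * g x \<partial>\<mu>)"
proof -
  note D = invariant_measuresD[OF \<mu>]
  interpret prob_space \<mu> by (rule D(1))
  define m where "m = max_birkhoff_sum T g"
  define P where "P = (\<lambda>N. {x. 0 < m N x})"
  have m_meas: "m N \<in> borel_measurable borel" for N
    unfolding m_def by (rule max_birkhoff_sum_measurable[OF T g])
  have P_sets: "P N \<in> sets borel" for N
    unfolding P_def using m_meas[of N] by measurable
  have ind_meas: "indicator A \<in> borel_measurable borel" if "A \<in> sets borel" for A :: "'a set"
    using that by simp
  have bounded_int: "integrable \<mu> h" if "h \<in> borel_measurable borel" "\<And>x. \<bar>h x\<bar> \<le> C" for h :: "'a \<Rightarrow> real" and C
    using finite_borel_integrable[OF prob_space.axioms(1)[OF D(1)] D(2) that] .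
  have mE: "(\<lambda>x. indicator E x * m N x) \<in> borel_measurable borel" for N
    by (intro borel_measurable_times ind_meas E m_meas)
  have Em_bd: "\<bar>indicator E x * m N x\<bar> \<le> real N * B" for N x
    using max_birkhoff_sum_bounded[of g B T N x, OF B]
      abs_ge_zero[of "max_birkhoff_sum T g N x"]
    by (auto simp: m_def indicator_def)
  have ge0: "0 \<le> (\<integral>x. indicator E x * (indicator (P N) x * g x) \<partial>\<mu>)" for N
  proof (cases N)
    case 0
    then have "P N = {}" by (simp add: P_def m_def)
    then show ?thesis by simp
  next
    case (Suc N')
    have "(\<integral>x. indicator E x * m N x \<partial>\<mu>) - (\<integral>x. indicator E (T x) * m N (T x) \<partial>\<mu>) = 0"
      using invariant_integral[OF \<mu> T mE] by simp
    moreover have "integrable \<mu> (\<lambda>x. indicator E (T x) * m N (T x))"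
      by (rule bounded_int[OF measurable_compose[OF T mE] Em_bd])
    ultimately have "0 = (\<integral>x. indicator E x * m N x - indicator E (T x) * m N (T x) \<partial>\<mu>)"
      using bounded_int[OF mE Em_bd, of N] by simp
    also have "\<dots> \<le> (\<integral>x. indicator E x * (indicator (P N) x * g x) \<partial>\<mu>)"
    proof (rule integral_mono)
      show "integrable \<mu> (\<lambda>x. indicator E x * m N x - indicator E (T x) * m N (T x))"
        using bounded_int[OF mE Em_bd, of N] bounded_int[OF measurable_compose[OF T mE] Em_bd, of N] by simp
      show "integrable \<mu> (\<lambda>x. indicator E x * (indicator (P N) x * g x))"
      proof (rule bounded_int[of _ B])
        show "(\<lambda>x. indicator E x * (indicator (P N) x * g x)) \<in> borel_measurable borel"
          by (intro borel_measurable_times ind_meas E P_sets g)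
        show "\<bar>indicator E x * (indicator (P N) x * g x)\<bar> \<le> B" for x
          using B[of x] order_trans[OF abs_ge_zero B[of x]] by (auto simp: indicator_def)
      qed
      fix x
      have inv: "indicator E (T x) = (indicator E x :: real)"
        using E(2) by (auto simp: indicator_def)
      have nn: "0 \<le> m N (T x)" "0 \<le> m N x"
        by (simp_all add: m_def max_birkhoff_sum_nonneg)
      have "m N x - m N (T x) \<le> indicator (P N) x * g x"
      proof (cases "x \<in> P N")
        case True
        then have "m N x = g x + m N' (T x)"
          by (auto simp: P_def m_def Suc max_def split: if_splits)
        also have "\<dots> \<le> g x + m N (T x)"
          using max_birkhoff_sum_mono[of T g N' "T x"] unfolding m_def Suc by simp
        finally show ?thesis using True by simp
      next
        case False
        then show ?thesis using nn by (simp add: P_def)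
      qed
      then show "indicator E x * m N x - indicator E (T x) * m N (T x) \<le> indicator E x * (indicator (P N) x * g x)"
        by (cases "x \<in> E") (simp_all add: inv)
    qed
    finally show ?thesis .
  qed
  have "(\<lambda>N. \<integral>x. indicator E x * (indicator (P N) x * g x) \<partial>\<mu>) \<longlonglongrightarrow> (\<integral>x. indicator E x * g x \<partial>\<mu>)"
  proof (rule integral_dominated_convergence[where w = "\<lambda>x. B"])
    show "AE x in \<mu>. (\<lambda>N. indicator E x * (indicator (P N) x * g x)) \<longlonglongrightarrow> indicator E x * g x"
    proof (rule AE_I2)
      fix x
      show "(\<lambda>N. indicator E x * (indicator (P N) x * g x)) \<longlonglongrightarrow> indicator E x * g x"
      proof (cases "x \<in> E")
        case True
        obtain n where n: "0 < birkhoff_sum T g n x" using pos[OF True] by blast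
        have "x \<in> P N" if "n \<le> N" for N
        proof -
          have "incseq (\<lambda>N. m N x)"
            unfolding m_def by (rule incseq_SucI) (rule max_birkhoff_sum_mono)
          then have "m n x \<le> m N x"
            using that by (rule incseqD)
          then show ?thesis
            using n birkhoff_sum_le_max[of T g n x] unfolding P_def m_def by simp
        qed
        then show ?thesis
          by (intro tendsto_eventually eventually_sequentiallyI[of n]) simp
      qed simp
    qed
    show "AE x in \<mu>. norm (indicator E x * (indicator (P N) x * g x)) \<le> B" for N
      using B abs_ge_zero[THEN order_trans, OF B] by (auto simp: indicator_def)
  qed (simp_all add: measurable_cong_sets[OF D(2)] borel_measurable_times ind_meas E P_sets g)
  then show ?thesis
    by (rule tendsto_lowerbound) (auto simp: ge0)
qed

text \<open>
  The exceptional sets for pointwise convergence. With \<open>g - c\<close> in place of \<open>g\<close> this set contains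
  all points whose averages have upper limit above \<open>c\<close>, and outside it the upper limit is at most \<open>c\<close>.
  In contrast to sets defined by upper limits, it is visibly strictly invariant, since passing from
  \<open>x\<close> to \<open>T x\<close> shifts all sums by the single number \<open>g x\<close>.
\<close>

definition unbounded_sums :: "('a \<Rightarrow> 'a) \<Rightarrow> ('a \<Rightarrow> real) \<Rightarrow> 'a set" where
  "unbounded_sums T g = {x. \<forall>K::nat. \<exists>n. real K < birkhoff_sum T g n x}"

lemma unbounded_sums_sets:
  assumes "T \<in> borel \<rightarrow>\<^sub>M borel" "g \<in> borel_measurable borel"
  shows "unbounded_sums T g \<in> sets borel"
proof -
  have "{x. real K < birkhoff_sum T g n x} \<in> sets borel" for K n
    using birkhoff_sum_measurable[OF assms, of n] by measurable
  moreover have "unbounded_sums T g = (\<Inter>K. \<Union>n. {x. real K < birkhoff_sum T g n x})"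
    by (auto simp: unbounded_sums_def)
  ultimately show ?thesis by (auto intro!: sets.countable_INT'' sets.countable_UN)
qed

lemma unbounded_sums_invariant: "T -` unbounded_sums T g = unbounded_sums T g"
proof (intro equalityI subsetI)
  fix x assume "x \<in> T -` unbounded_sums T g"
  then have x: "T x \<in> unbounded_sums T g" by simp
  show "x \<in> unbounded_sums T g"
    unfolding unbounded_sums_def
  proof safe
    fix K :: nat
    obtain K' :: nat where "real K + \<bar>g x\<bar> \<le> K'" using real_arch_simple by blast
    moreover obtain n where "real K' < birkhoff_sum T g n (T x)"
      using x by (auto simp: unbounded_sums_def)
    ultimately have "real K < birkhoff_sum T g (Suc n) x"
      by (simp add: birkhoff_sum_Suc)
    then show "\<exists>n. real K < birkhoff_sum T g n x" by blast
  qed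
next
  fix x assume x: "x \<in> unbounded_sums T g"
  show "x \<in> T -` unbounded_sums T g"
    unfolding unbounded_sums_def vimage_Collect_eq
  proof safe
    fix K :: nat
    obtain K' :: nat where K': "real K + \<bar>g x\<bar> \<le> K'" using real_arch_simple by blast
    obtain n where n: "real K' < birkhoff_sum T g n x"
      using x by (auto simp: unbounded_sums_def)
    then obtain m where "n = Suc m"
      by (cases n) auto
    with n K' have "real K < birkhoff_sum T g m (T x)"
      by (simp add: birkhoff_sum_Suc)
    then show "\<exists>n. real K < birkhoff_sum T g n (T x)" by blast
  qed
qed

lemma not_unbounded_sums:
  assumes x: "x \<notin> unbounded_sums T (\<lambda>x. g x - c)" and c: "c < c'"
  shows "\<forall>\<^sub>F n in sequentially. birkhoff_sum T g n x < real n * c'"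
proof -
  obtain K :: nat where K: "\<And>n. birkhoff_sum T g n x - real n * c \<le> real K"
    using x by (auto simp: unbounded_sums_def birkhoff_sum_diff_const not_less)
  obtain N :: nat where N: "real K < real N * (c' - c)"
    using reals_Archimedean3[of "c' - c"] c by auto
  have "birkhoff_sum T g n x < real n * c'" if "n \<ge> N" for n
  proof -
    have "real N * (c' - c) \<le> real n * (c' - c)"
      using that c by (intro mult_right_mono) auto
    with K[of n] N show ?thesis by (simp add: algebra_simps)
  qed
  then show ?thesis by (auto simp: eventually_sequentially)
qed

lemma unbounded_sumsI:
  assumes ev: "\<forall>\<^sub>F n in sequentially. real n * c' \<le> birkhoff_sum T g n x" and c: "c < c'"
  shows "x \<in> unbounded_sums T (\<lambda>x. g x - c)"
  unfolding unbounded_sums_def birkhoff_sum_diff_const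
proof safe
  fix K :: nat
  obtain N where N: "\<And>n. n \<ge> N \<Longrightarrow> real n * c' \<le> birkhoff_sum T g n x"
    using ev by (auto simp: eventually_sequentially)
  obtain N' :: nat where N': "real K < real N' * (c' - c)"
    using reals_Archimedean3[of "c' - c"] c by auto
  have "real N' * (c' - c) \<le> real (max N N') * (c' - c)"
    using c by (intro mult_right_mono) auto
  then have "real K < birkhoff_sum T g (max N N') x - real (max N N') * c"
    using N[of "max N N'"] N' by (simp add: algebra_simps)
  then show "\<exists>n. real K < birkhoff_sum T g n x - real n * c" by blast
qed

lemma tendsto_averageI:
  assumes "\<And>c. c < r \<Longrightarrow> \<forall>\<^sub>F n in sequentially. real n * c < s n"
    and "\<And>c. r < c \<Longrightarrow> \<forall>\<^sub>F n in sequentially. s n < real n * c"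
  shows "(\<lambda>n. s n / real n) \<longlonglongrightarrow> r"
proof (rule order_tendstoI)
  fix a
  show "\<forall>\<^sub>F n in sequentially. a < s n / real n" if "a < r"
    using assms(1)[OF that] eventually_gt_at_top[of 0]
    by eventually_elim (simp add: field_simps)
  show "\<forall>\<^sub>F n in sequentially. s n / real n < a" if "r < a"
    using assms(2)[OF that] eventually_gt_at_top[of 0]
    by eventually_elim (simp add: field_simps)
qed


lemma bounded_integrable:
  fixes h :: "'a::topological_space \<Rightarrow> real"
  assumes "\<mu> \<in> invariant_measures T" "h \<in> borel_measurable borel" "\<And>x. \<bar>h x\<bar> \<le> C"
  shows "integrable \<mu> h"
  using assms invariant_measuresD[OF assms(1)]
  by (intro finite_borel_integrable[of _ _ C]) (simp_all add: prob_space.axioms)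

lemma indicator_const_integral:
  fixes \<mu> :: "'a::topological_space measure"
  assumes "\<mu> \<in> invariant_measures T" "A \<in> sets borel" "g \<in> borel_measurable borel" "\<And>x. \<bar>g x\<bar> \<le> B"
  shows "(\<integral>x. indicator A x * (g x - c) \<partial>\<mu>) = (\<integral>x. indicator A x * g x \<partial>\<mu>) - c * measure \<mu> A"
    and "integrable \<mu> (\<lambda>x. indicator A x * g x)"
proof -
  interpret prob_space \<mu> using invariant_measuresD[OF assms(1)] by simp
  have A: "A \<in> sets \<mu>" using invariant_measuresD[OF assms(1)] assms(2) by simp
  have intA: "integrable \<mu> (\<lambda>x. c * indicator A x)"
    using A by (intro integrable_mult_right integrable_real_indicator) (simp_all add: less_top[symmetric])
  show int: "integrable \<mu> (\<lambda>x. indicator A x * g x)"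
  proof (rule bounded_integrable[OF assms(1), of _ B])
    show "(\<lambda>x. indicator A x * g x) \<in> borel_measurable borel"
      by (intro borel_measurable_times borel_measurable_indicator assms)
    show "\<bar>indicator A x * g x\<bar> \<le> B" for x
      using assms(4)[of x] order_trans[OF abs_ge_zero assms(4)[of x]] by (auto simp: indicator_def)
  qed
  have "(\<integral>x. indicator A x * (g x - c) \<partial>\<mu>) = (\<integral>x. indicator A x * g x - c * indicator A x \<partial>\<mu>)"
    by (simp add: algebra_simps)
  also have "\<dots> = (\<integral>x. indicator A x * g x \<partial>\<mu>) - c * measure \<mu> A"
    using int intA A by simp
  finally show "(\<integral>x. indicator A x * (g x - c) \<partial>\<mu>) = (\<integral>x. indicator A x * g x \<partial>\<mu>) - c * measure \<mu> A" .
qed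

lemma unbounded_sums_integral:
  fixes T :: "'a::topological_space \<Rightarrow> 'a"
  assumes T: "T \<in> borel \<rightarrow>\<^sub>M borel" and \<mu>: "\<mu> \<in> invariant_measures T"
    and g: "g \<in> borel_measurable borel" and B: "\<And>x. \<bar>g x\<bar> \<le> B"
    and E: "E \<in> sets borel" "T -` E = E" "E \<subseteq> unbounded_sums T (\<lambda>x. g x - c)"
  shows "c * measure \<mu> E \<le> (\<integral>x. indicator E x * g x \<partial>\<mu>)"
proof -
  have "0 \<le> (\<integral>x. indicator E x * (g x - c) \<partial>\<mu>)"
  proof (rule maximal_ergodic[OF T \<mu> _ _ E(1,2), of _ "B + \<bar>c\<bar>"])
    show "(\<lambda>x. g x - c) \<in> borel_measurable borel" using g by simp
    show "\<bar>g x - c\<bar> \<le> B + \<bar>c\<bar>" for x using B[of x] by linarith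
    show "\<exists>n. 0 < birkhoff_sum T (\<lambda>x. g x - c) n x" if "x \<in> E" for x
    proof -
      have "x \<in> unbounded_sums T (\<lambda>x. g x - c)" using that E by blast
      then have "\<exists>n. real 0 < birkhoff_sum T (\<lambda>x. g x - c) n x"
        unfolding unbounded_sums_def by blast
      then show ?thesis by simp
    qed
  qed
  then show ?thesis
    using indicator_const_integral(1)[OF \<mu> E(1) g B, of c] by simp
qed

lemma birkhoff_upperI:
  fixes T :: "'a::topological_space \<Rightarrow> 'a"
  assumes \<mu>: "\<mu> \<in> invariant_measures T" and T: "T \<in> borel \<rightarrow>\<^sub>M borel" and g: "g \<in> borel_measurable borel"
    and null: "\<And>c. r < c \<Longrightarrow> measure \<mu> (unbounded_sums T (\<lambda>x. g x - c)) = 0"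
  shows "AE x in \<mu>. \<forall>c>r. \<forall>\<^sub>F n in sequentially. birkhoff_sum T g n x < real n * c"
proof -
  note D = invariant_measuresD[OF \<mu>]
  interpret prob_space \<mu> by (rule D(1))
  have sets: "unbounded_sums T (\<lambda>x. g x - c) \<in> sets \<mu>" for c
    using unbounded_sums_sets[OF T, of "\<lambda>x. g x - c"] g D by simp
  have "AE x in \<mu>. \<forall>k::nat. x \<notin> unbounded_sums T (\<lambda>x. g x - (r + 1 / Suc k))"
    unfolding AE_all_countable
  proof
    fix k :: nat
    show "AE x in \<mu>. x \<notin> unbounded_sums T (\<lambda>x. g x - (r + 1 / Suc k))"
      using null[of "r + 1 / Suc k"] sets by (intro AE_not_in null_setsI) (auto simp: emeasure_eq_measure)
  qed
  then show ?thesis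
  proof eventually_elim
    case (elim x)
    show ?case
    proof safe
      fix c assume "r < c"
      then obtain k :: nat where "1 / Suc k < c - r"
        using nat_approx_posE[of "c - r"] by auto
      then show "\<forall>\<^sub>F n in sequentially. birkhoff_sum T g n x < real n * c"
        using elim by (intro not_unbounded_sums[of _ _ _ "r + 1 / Suc k"]) auto
    qed
  qed
qed

text \<open>
  An exceptional set at a level \<open>c\<close> above the mean has measure \<open>0\<close> or \<open>1\<close>; full measure would
  make the mean at least \<open>c\<close> by the maximal ergodic theorem.
\<close>

lemma birkhoff_upper_ergodic:
  fixes T :: "'a::topological_space \<Rightarrow> 'a"
  assumes \<mu>: "ergodic_measure T \<mu>" and T: "T \<in> borel \<rightarrow>\<^sub>M borel"
    and g: "g \<in> borel_measurable borel" and B: "\<And>x. \<bar>g x\<bar> \<le> B"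
  shows "AE x in \<mu>. \<forall>c>\<integral>x. g x \<partial>\<mu>. \<forall>\<^sub>F n in sequentially. birkhoff_sum T g n x < real n * c"
proof (rule birkhoff_upperI[OF _ T g])
  show inv: "\<mu> \<in> invariant_measures T" using \<mu> by (simp add: ergodic_measure_def)
  interpret prob_space \<mu> using invariant_measuresD[OF inv] by simp
  fix c assume c: "(\<integral>x. g x \<partial>\<mu>) < c"
  let ?U = "unbounded_sums T (\<lambda>x. g x - c)"
  have U: "?U \<in> sets borel" using unbounded_sums_sets[OF T, of "\<lambda>x. g x - c"] g by simp
  have "measure \<mu> ?U = 0 \<or> measure \<mu> ?U = 1"
    using \<mu> U unbounded_sums_invariant[of T "\<lambda>x. g x - c"] by (simp add: ergodic_measure_def)
  moreover have False if 1: "measure \<mu> ?U = 1"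
  proof -
    have "AE x in \<mu>. x \<in> ?U"
      using 1 U invariant_measuresD[OF inv] by (subst prob_eq_1[symmetric]) auto
    then have AE_eq: "AE x in \<mu>. indicator ?U x * g x = g x"
      by eventually_elim simp
    have "(\<integral>x. indicator ?U x * g x \<partial>\<mu>) = (\<integral>x. g x \<partial>\<mu>)"
      by (rule integral_cong_AE[OF _ _ AE_eq])
        (simp_all only: measurable_cong_sets[OF invariant_measuresD(2)[OF inv] refl] g
          borel_measurable_times borel_measurable_indicator U)
    with unbounded_sums_integral[OF T inv g B U unbounded_sums_invariant order_refl] 1 c
    show False by simp
  qed
  ultimately show "measure \<mu> ?U = 0" by blast
qed

theorem birkhoff_ergodic:
  fixes T :: "'a::topological_space \<Rightarrow> 'a"
  assumes \<mu>: "ergodic_measure T \<mu>" and T: "T \<in> borel \<rightarrow>\<^sub>M borel"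
    and g: "g \<in> borel_measurable borel" and B: "\<And>x. \<bar>g x\<bar> \<le> B"
  shows "AE x in \<mu>. (\<lambda>n. birkhoff_sum T g n x / real n) \<longlonglongrightarrow> (\<integral>x. g x \<partial>\<mu>)"
proof -
  have "AE x in \<mu>. \<forall>c>\<integral>x. - g x \<partial>\<mu>. \<forall>\<^sub>F n in sequentially. birkhoff_sum T (\<lambda>x. - g x) n x < real n * c"
    using g B by (intro birkhoff_upper_ergodic[OF \<mu> T]) auto
  with birkhoff_upper_ergodic[OF \<mu> T g B] show ?thesis
  proof eventually_elim
    case (elim x)
    show ?case
    proof (rule tendsto_averageI)
      fix c assume "c < (\<integral>x. g x \<partial>\<mu>)"
      then have "\<forall>\<^sub>F n in sequentially. birkhoff_sum T (\<lambda>x. - g x) n x < real n * (- c)"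
        using elim(2) by (metis integral_minus neg_less_iff_less)
      then show "\<forall>\<^sub>F n in sequentially. real n * c < birkhoff_sum T g n x"
        by (simp add: birkhoff_sum_minus)
    qed (use elim in blast)
  qed
qed

text \<open>
  For a measure that need not be ergodic the averages converge to the integral as soon as their lower
  limit is almost everywhere at least the integral. For \<open>c' < r < c\<close>, with \<open>r\<close> the integral, let \<open>U\<close> be
  the set where the sums of \<open>g - c\<close> are unbounded. Almost every other point has unbounded sums of \<open>g - c'\<close>.
  The maximal ergodic theorem on \<open>U\<close> and on its complement gives
  \<open>r \<ge> c * \<mu>(U) + c' * (1 - \<mu>(U))\<close>, and \<open>c'\<close> tending to \<open>r\<close> forces \<open>\<mu>(U) = 0\<close>.
\<close>

theorem birkhoff_of_lower_bound:
  fixes T :: "'a::topological_space \<Rightarrow> 'a"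
  assumes \<mu>: "\<mu> \<in> invariant_measures T" and T: "T \<in> borel \<rightarrow>\<^sub>M borel"
    and g: "g \<in> borel_measurable borel" and B: "\<And>x. \<bar>g x\<bar> \<le> B"
    and lower: "AE x in \<mu>. \<forall>c<\<integral>x. g x \<partial>\<mu>. \<forall>\<^sub>F n in sequentially. real n * c < birkhoff_sum T g n x"
  shows "AE x in \<mu>. (\<lambda>n. birkhoff_sum T g n x / real n) \<longlonglongrightarrow> (\<integral>x. g x \<partial>\<mu>)"
proof -
  note D = invariant_measuresD[OF \<mu>]
  interpret prob_space \<mu> by (rule D(1))
  define r where "r = (\<integral>x. g x \<partial>\<mu>)"
  have U_sets: "unbounded_sums T (\<lambda>x. g x - c) \<in> sets borel" for c
    using unbounded_sums_sets[OF T, of "\<lambda>x. g x - c"] g by simp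
  have "AE x in \<mu>. \<forall>c>r. \<forall>\<^sub>F n in sequentially. birkhoff_sum T g n x < real n * c"
  proof (rule birkhoff_upperI[OF \<mu> T g])
    fix c assume c: "r < c"
    define U where "U = unbounded_sums T (\<lambda>x. g x - c)"
    have U: "U \<in> sets borel" "T -` U = U" "U \<subseteq> unbounded_sums T (\<lambda>x. g x - c)"
      unfolding U_def by (simp_all only: U_sets unbounded_sums_invariant order_refl)
    have bound: "(c - r) * measure \<mu> U \<le> r - c'" if c': "c' < r" for c'
    proof -
      define V where "V = unbounded_sums T (\<lambda>x. g x - c') - U"
      have "T -` unbounded_sums T (\<lambda>x. g x - c') - T -` U = unbounded_sums T (\<lambda>x. g x - c') - U"
        by (simp only: unbounded_sums_invariant U(2))
      then have V: "V \<in> sets borel" "T -` V = V" "V \<subseteq> unbounded_sums T (\<lambda>x. g x - c')"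
        using U_sets U(1) by (auto simp: V_def)
      have AE_V: "AE x in \<mu>. x \<in> V \<longleftrightarrow> x \<notin> U"
        using lower
      proof eventually_elim
        case (elim x)
        have "\<forall>\<^sub>F n in sequentially. real n * ((c' + r) / 2) < birkhoff_sum T g n x"
          by (rule elim[rule_format]) (use c' in \<open>simp add: r_def\<close>)
        then have "\<forall>\<^sub>F n in sequentially. real n * ((c' + r) / 2) \<le> birkhoff_sum T g n x"
          by eventually_elim simp
        then have "x \<in> unbounded_sums T (\<lambda>x. g x - c')"
          by (rule unbounded_sumsI) (use c' in simp)
        then show ?case by (auto simp: V_def)
      qed
      have "r = (\<integral>x. indicator U x * g x + indicator V x * g x \<partial>\<mu>)"
        unfolding r_def
      proof (rule integral_cong_AE)
        show "AE x in \<mu>. g x = indicator U x * g x + indicator V x * g x"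
          using AE_V by eventually_elim (auto simp: indicator_def)
      qed (use U V g in \<open>auto simp: measurable_cong_sets[OF D(2)]\<close>)
      also have "\<dots> = (\<integral>x. indicator U x * g x \<partial>\<mu>) + (\<integral>x. indicator V x * g x \<partial>\<mu>)"
        using indicator_const_integral(2)[OF \<mu> U(1) g B] indicator_const_integral(2)[OF \<mu> V(1) g B] by simp
      also have "\<dots> \<ge> c * measure \<mu> U + c' * measure \<mu> V"
        using unbounded_sums_integral[OF T \<mu> g B U] unbounded_sums_integral[OF T \<mu> g B V] by simp
      finally have "c * measure \<mu> U + c' * measure \<mu> V \<le> r" .
      moreover have "measure \<mu> V = 1 - measure \<mu> U"
      proof -
        have "measure \<mu> V = measure \<mu> (space \<mu> - U)"
          using AE_V U V D by (intro measure_eq_AE) auto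
        then show ?thesis using prob_compl[of U] U D by simp
      qed
      moreover have "(r - c') * measure \<mu> U \<ge> 0"
        using c' by simp
      ultimately show ?thesis by (simp add: algebra_simps)
    qed
    have "(c - r) * measure \<mu> U \<le> 0"
    proof (rule field_le_epsilon)
      fix e :: real assume "0 < e"
      then show "(c - r) * measure \<mu> U \<le> 0 + e" using bound[of "r - e"] by simp
    qed
    then show "measure \<mu> (unbounded_sums T (\<lambda>x. g x - c)) = 0"
      using c measure_nonneg[of \<mu> U] by (simp add: U_def[symmetric] mult_le_0_iff)
  qed
  with lower show ?thesis
    unfolding r_def
  proof eventually_elim
    case (elim x)
    then show ?case by (intro tendsto_averageI) auto
  qed
qed

section \<open>Generic points\<close>

lemma uniform_modulus:
  fixes f :: "'a::metric_space \<Rightarrow> real"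
  assumes X: "compact (UNIV :: 'a set)" and f: "continuous_on UNIV f" and e: "0 < e"
  obtains d where "0 < d" "\<And>x y. dist x y < d \<Longrightarrow> \<bar>f x - f y\<bar> < e"
proof -
  have "uniformly_continuous_on UNIV f"
    by (rule compact_uniformly_continuous[OF f X])
  then show ?thesis
    using that e unfolding uniformly_continuous_on_def by (metis UNIV_I dist_commute dist_real_def)
qed

text \<open>
  The form in which continuity is used: integrating or averaging the right-hand side turns a bound on
  mean distances into a bound on mean differences of \<open>f\<close>.
\<close>

lemma linear_modulus:
  fixes f :: "'a::metric_space \<Rightarrow> real"
  assumes X: "compact (UNIV :: 'a set)" and f: "continuous_on UNIV f" and e: "0 < e"
  obtains C where "0 < C" "\<And>x y. \<bar>f x - f y\<bar> \<le> e + C * dist x y"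
proof -
  obtain d where d: "0 < d" "\<And>x y. dist x y < d \<Longrightarrow> \<bar>f x - f y\<bar> < e"
    using uniform_modulus[OF assms] by blast
  obtain B where B: "0 < B" "\<And>x. \<bar>f x\<bar> \<le> B"
    using bounded_continuous[OF X f] by blast
  have "\<bar>f x - f y\<bar> \<le> e + (2 * B / d) * dist x y" for x y
  proof (cases "dist x y < d")
    case True
    have "0 \<le> (2 * B / d) * dist x y" using B d by simp
    then show ?thesis using d(2)[OF True] by linarith
  next
    case False
    then have "(2 * B / d) * d \<le> (2 * B / d) * dist x y"
      using B d by (intro mult_left_mono) auto
    then show ?thesis using B(2)[of x] B(2)[of y] d e by simp
  qed
  then show ?thesis using that[of "2 * B / d"] B d by simp
qed

lemma quasi_generic_iff_real:
  fixes \<mu> :: "'a::metric_space measure"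
  assumes X: "compact (UNIV :: 'a set)" and \<mu>: "prob_space \<mu>" "sets \<mu> = sets borel"
  shows "quasi_generic T n \<mu> x \<longleftrightarrow> (\<forall>f. continuous_on UNIV f \<longrightarrow>
    (\<lambda>k. birkhoff_sum T f (n k) x / real (n k)) \<longlonglongrightarrow> (\<integral>x. f x \<partial>\<mu>))" (is "_ \<longleftrightarrow> ?R")
proof
  assume q: "quasi_generic T n \<mu> x"
  show ?R
  proof safe
    fix f :: "'a \<Rightarrow> real" assume f: "continuous_on UNIV f"
    then have "continuous_on UNIV (\<lambda>x. complex_of_real (f x))"
      by (intro continuous_intros)
    with q have "(\<lambda>k. (1 / of_nat (n k)) * (\<Sum>j<n k. complex_of_real (f ((T ^^ j) x))))
        \<longlonglongrightarrow> (\<integral>x. complex_of_real (f x) \<partial>\<mu>)"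
      unfolding quasi_generic_def by blast
    then have "(\<lambda>k. complex_of_real (birkhoff_sum T f (n k) x / real (n k))) \<longlonglongrightarrow> complex_of_real (\<integral>x. f x \<partial>\<mu>)"
      by (simp add: birkhoff_sum_def)
    then show "(\<lambda>k. birkhoff_sum T f (n k) x / real (n k)) \<longlonglongrightarrow> (\<integral>x. f x \<partial>\<mu>)"
      by (simp only: tendsto_of_real_iff)
  qed
next
  assume R: ?R
  show "quasi_generic T n \<mu> x"
    unfolding quasi_generic_def
  proof safe
    fix f :: "'a \<Rightarrow> complex" assume f: "continuous_on UNIV f"
    have Re_f: "continuous_on UNIV (\<lambda>x. Re (f x))" and Im_f: "continuous_on UNIV (\<lambda>x. Im (f x))"
      using f by (intro continuous_intros; simp)+
    have "integrable \<mu> (\<lambda>x. complex_of_real (Re (f x)) + \<i> * complex_of_real (Im (f x)))"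
      using continuous_integrable[OF X \<mu> Re_f] continuous_integrable[OF X \<mu> Im_f]
      by (intro Bochner_Integration.integrable_add integrable_mult_right integrable_of_real)
    then have int: "integrable \<mu> f"
      by (simp add: complex_eq[symmetric])
    have avg: "Re (1 / of_nat m * z) = Re z / real m" "Im (1 / of_nat m * z) = Im z / real m" for m z
      by (simp_all add: Re_divide_of_nat Im_divide_of_nat)
    show "(\<lambda>k. (1 / of_nat (n k)) * (\<Sum>j<n k. f ((T ^^ j) x))) \<longlonglongrightarrow> integral\<^sup>L \<mu> f"
      unfolding tendsto_complex_iff avg
      using R[rule_format, OF Re_f] R[rule_format, OF Im_f] int by (simp add: birkhoff_sum_def)
  qed
qed

text \<open>
  The partition consists of the sets \<open>{x. p x = i}\<close>, and \<open>c i\<close> is a centre of the piece with index \<open>i\<close>.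
\<close>

lemma finite_borel_partition:
  fixes e :: real
  assumes X: "compact (UNIV :: ('a::metric_space) set)" and e: "0 < e"
  obtains N :: nat and c :: "nat \<Rightarrow> 'a::metric_space" and p :: "'a::metric_space \<Rightarrow> nat"
  where "\<And>x. p x < N" "\<And>x. dist x (c (p x)) < e" "\<And>i. {x. p x = i} \<in> sets borel"
proof -
  obtain K :: "'a set" where K: "finite K" "UNIV \<subseteq> (\<Union>y\<in>K. ball y e)"
  proof (rule compactE_image[OF X, of UNIV "\<lambda>y. ball y e"])
    show "UNIV \<subseteq> (\<Union>y\<in>UNIV. ball y e)"
      using e by (auto intro: centre_in_ball[THEN iffD2])
  qed (use that in blast, simp)
  obtain c :: "nat \<Rightarrow> 'a" and N where c: "K = c ` {i. i < N}"
    using finite_imp_nat_seg_image_inj_on[OF K(1)] by blast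
  define p where "p = (\<lambda>x. LEAST i. dist x (c i) < e)"
  have ex: "\<exists>i<N. dist x (c i) < e" for x
  proof -
    have "x \<in> (\<Union>y\<in>K. ball y e)" using K(2) by blast
    then show ?thesis using c by (auto simp: dist_commute)
  qed
  show ?thesis
  proof (rule that)
    fix x
    obtain i where i: "i < N" "dist x (c i) < e" using ex by blast
    show "p x < N"
      using i Least_le[of "\<lambda>i. dist x (c i) < e" i] by (auto simp: p_def)
    show "dist x (c (p x)) < e"
      unfolding p_def by (rule LeastI[of "\<lambda>i. dist x (c i) < e", OF i(2)])
  next
    fix i
    have "{x. p x = i} = {x. dist x (c i) < e} - (\<Union>j<i. {x. dist x (c j) < e})"
    proof safe
      fix x
      show "dist x (c (p x)) < e"
        unfolding p_def using ex[of x] by (auto intro: LeastI)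
      show False if "j < p x" "dist x (c j) < e" for j
        using that not_less_Least[of j "\<lambda>i. dist x (c i) < e"] by (simp add: p_def)
    next
      fix x assume "dist x (c i) < e" "x \<notin> (\<Union>j<i. {x. dist x (c j) < e})"
      then show "p x = i"
        unfolding p_def by (intro Least_equality) (auto simp: not_less[symmetric])
    qed
    moreover have "open {x. dist x (c j) < e}" for j
      by (intro open_Collect_less continuous_intros)
    ultimately show "{x. p x = i} \<in> sets borel" by auto
  qed
qed

text \<open>
  Take Borel partitions into finitely many pieces of diameter tending to \<open>0\<close>. Almost every point visits
  each of these countably many pieces with the right frequency, and every continuous function is uniformly
  close to a function that is constant on the pieces of a partition.
\<close>

theorem AE_generic:
  fixes T :: "'a::metric_space \<Rightarrow> 'a"
  assumes X: "compact (UNIV :: 'a set)" and T: "continuous_on UNIV T" and \<mu>: "ergodic_measure T \<mu>"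
  shows "AE x in \<mu>. x \<in> Gen T \<mu>"
proof -
  have inv: "\<mu> \<in> invariant_measures T" using \<mu> by (simp add: ergodic_measure_def)
  note D = invariant_measuresD[OF inv]
  interpret prob_space \<mu> by (rule D(1))
  have Tm: "T \<in> borel \<rightarrow>\<^sub>M borel"
    by (rule borel_measurable_continuous_onI[OF T])
  have "\<exists>(N::nat) (c :: nat \<Rightarrow> 'a) (p :: 'a \<Rightarrow> nat). (\<forall>x. p x < N) \<and> (\<forall>x. dist x (c (p x)) < 1 / real (Suc k)) \<and> (\<forall>i. {x. p x = i} \<in> sets borel)"
    for k
  proof -
    have "0 < 1 / real (Suc k)" by simp
    from finite_borel_partition[OF X this] obtain N :: nat and c :: "nat \<Rightarrow> 'a" and p :: "'a \<Rightarrow> nat"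
      where "\<And>x. p x < N" "\<And>x. dist x (c (p x)) < 1 / real (Suc k)" "\<And>i. {x. p x = i} \<in> sets borel"
      by metis
    then show ?thesis by (intro exI[of _ N] exI[of _ c] exI[of _ p]) simp
  qed
  then obtain N :: "nat \<Rightarrow> nat" and c :: "nat \<Rightarrow> nat \<Rightarrow> 'a" and p :: "nat \<Rightarrow> 'a \<Rightarrow> nat"
    where p: "\<And>k x. p k x < N k" "\<And>k x. dist x (c k (p k x)) < 1 / real (Suc k)" "\<And>k i. {x. p k x = i} \<in> sets borel"
    by metis
  define A where "A = (\<lambda>k i. {x. p k x = i})"
  have A: "A k i \<in> sets borel" for k i using p by (simp add: A_def)
  have "AE x in \<mu>. \<forall>k i. (\<lambda>n. birkhoff_sum T (indicator (A k i)) n x / real n) \<longlonglongrightarrow> (\<integral>x. indicator (A k i) x \<partial>\<mu>)"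
    unfolding AE_all_countable
  proof (intro allI)
    fix k i
    show "AE x in \<mu>. (\<lambda>n. birkhoff_sum T (indicator (A k i)) n x / real n) \<longlonglongrightarrow> (\<integral>x. indicator (A k i) x \<partial>\<mu>)"
      by (rule birkhoff_ergodic[OF \<mu> Tm, of _ 1]) (auto intro: borel_measurable_indicator A simp: indicator_def)
  qed
  then show ?thesis
  proof eventually_elim
    case (elim x)
    have "quasi_generic T (\<lambda>k. k) \<mu> x"
      unfolding quasi_generic_iff_real[OF X D(1,2)]
    proof safe
      fix f :: "'a \<Rightarrow> real" assume f: "continuous_on UNIV f"
      show "(\<lambda>n. birkhoff_sum T f n x / real n) \<longlonglongrightarrow> (\<integral>x. f x \<partial>\<mu>)"
      proof (rule LIMSEQ_I)
        fix r :: real assume "0 < r"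
        define e where "e = r / 3"
        have e: "0 < e" using \<open>0 < r\<close> by (simp add: e_def)
        obtain d where d: "0 < d" "\<And>x y. dist x y < d \<Longrightarrow> \<bar>f x - f y\<bar> < e"
          using uniform_modulus[OF X f e] by blast
        obtain k :: nat where k: "1 / Suc k < d"
          using nat_approx_posE[OF d(1)] by auto
        define F where "F = (\<lambda>y. \<Sum>i<N k. f (c k i) * indicator (A k i) y)"
        have "F y = f (c k (p k y))" for y
        proof -
          have "F y = (\<Sum>i<N k. if i = p k y then f (c k i) else 0)"
            unfolding F_def A_def by (intro sum.cong) (auto simp: indicator_def)
          then show ?thesis using p(1)[of k y] by simp
        qed
        then have close: "\<bar>f y - F y\<bar> < e" for y
          using d(2)[of y "c k (p k y)"] p(2)[of y k] k by simp
        have F_sum: "birkhoff_sum T F n x = (\<Sum>i<N k. f (c k i) * birkhoff_sum T (indicator (A k i)) n x)" for n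
          unfolding birkhoff_sum_def F_def by (subst sum.swap) (simp add: sum_distrib_left)
        have ind_int: "integrable \<mu> (indicator (A k i) :: 'a \<Rightarrow> real)" for i
          using A D by (intro integrable_real_indicator) (simp_all add: less_top[symmetric])
        have F_int: "integrable \<mu> F"
          unfolding F_def by (intro Bochner_Integration.integrable_sum integrable_mult_right ind_int)
        have "(\<lambda>n. \<Sum>i<N k. f (c k i) * (birkhoff_sum T (indicator (A k i)) n x / real n))
            \<longlonglongrightarrow> (\<Sum>i<N k. f (c k i) * (\<integral>x. indicator (A k i) x \<partial>\<mu>))"
          using elim by (intro tendsto_sum tendsto_mult tendsto_const) blast
        moreover have "(\<Sum>i<N k. f (c k i) * (birkhoff_sum T (indicator (A k i)) n x / real n)) = birkhoff_sum T F n x / real n" for n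
          by (simp add: F_sum sum_divide_distrib)
        moreover have "(\<Sum>i<N k. f (c k i) * (\<integral>x. indicator (A k i) x \<partial>\<mu>)) = (\<integral>x. F x \<partial>\<mu>)"
          unfolding F_def using ind_int
          by (subst Bochner_Integration.integral_sum) (auto intro: integrable_mult_right)
        ultimately have "(\<lambda>n. birkhoff_sum T F n x / real n) \<longlonglongrightarrow> (\<integral>x. F x \<partial>\<mu>)"
          by simp
        from LIMSEQ_D[OF this e] obtain n0
          where n0: "\<And>n. n \<ge> n0 \<Longrightarrow> \<bar>birkhoff_sum T F n x / real n - (\<integral>x. F x \<partial>\<mu>)\<bar> < e"
          by auto
        have f_int: "integrable \<mu> f" by (rule continuous_integrable[OF X D(1,2) f])
        have int_close: "\<bar>(\<integral>x. F x \<partial>\<mu>) - (\<integral>x. f x \<partial>\<mu>)\<bar> \<le> e"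
        proof -
          have "\<bar>\<integral>x. f x - F x \<partial>\<mu>\<bar> \<le> (\<integral>x. \<bar>f x - F x\<bar> \<partial>\<mu>)"
            by (rule integral_abs_bound)
          also have "\<dots> \<le> (\<integral>x. e \<partial>\<mu>)"
            using f_int F_int close by (intro integral_mono) (auto intro: less_imp_le)
          finally show ?thesis using f_int F_int by (simp add: prob_space abs_minus_commute)
        qed
        have avg_close: "\<bar>birkhoff_sum T f n x / real n - birkhoff_sum T F n x / real n\<bar> \<le> e" if "n \<ge> 1" for n
        proof -
          have "\<bar>birkhoff_sum T f n x - birkhoff_sum T F n x\<bar> \<le> (\<Sum>j<n. \<bar>f ((T ^^ j) x) - F ((T ^^ j) x)\<bar>)"
            unfolding birkhoff_sum_def sum_subtractf[symmetric] by (rule sum_abs)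
          also have "\<dots> \<le> (\<Sum>j<n. e)"
            by (intro sum_mono less_imp_le close)
          finally show ?thesis
            using that by (simp add: diff_divide_distrib[symmetric] field_simps)
        qed
        have "norm (birkhoff_sum T f n x / real n - (\<integral>x. f x \<partial>\<mu>)) < r" if "n \<ge> max 1 n0" for n
        proof -
          have triangle: "\<bar>a - d\<bar> < r" if "\<bar>b - c\<bar> < e" "\<bar>c - d\<bar> \<le> e" "\<bar>a - b\<bar> \<le> e" for a b c d
            using that unfolding e_def by linarith
          show ?thesis
            unfolding real_norm_def
            by (rule triangle[OF n0 int_close avg_close]) (use that in auto)
        qed
        then show "\<exists>no. \<forall>n\<ge>no. norm (birkhoff_sum T f n x / real n - (\<integral>x. f x \<partial>\<mu>)) < r"
          by blast
      qed
    qed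
    then show ?case by (simp add: Gen_def)
  qed
qed

lemma normalized_functional_birkhoff:
  assumes "0 < n"
  shows "normalized_functional (\<lambda>f. birkhoff_sum T f n x / real n)"
  by standard (use assms in \<open>auto simp: birkhoff_sum_def sum.distrib add_divide_distrib
      sum_distrib_left[symmetric] intro!: divide_nonneg_nonneg sum_nonneg\<close>)

lemma invariant_measuresI_continuous:
  fixes T :: "'a::metric_space \<Rightarrow> 'a"
  assumes T: "continuous_on UNIV T" and \<mu>: "prob_space \<mu>" "sets \<mu> = sets borel"
    and eq: "\<And>f :: 'a \<Rightarrow> real. continuous_on UNIV f \<Longrightarrow> (\<integral>x. f (T x) \<partial>\<mu>) = (\<integral>x. f x \<partial>\<mu>)"
  shows "\<mu> \<in> invariant_measures T"
proof -
  interpret prob_space \<mu> by (rule \<mu>(1))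
  have Tm: "T \<in> measurable \<mu> borel"
    using borel_measurable_continuous_onI[OF T] by (simp add: measurable_cong_sets[OF \<mu>(2)])
  have "distr \<mu> borel T = \<mu>"
  proof (rule borel_measure_eqI)
    show "finite_measure (distr \<mu> borel T)"
      using prob_space_distr[OF Tm] by (simp add: prob_space.axioms)
    fix f :: "'a \<Rightarrow> real" assume f: "continuous_on UNIV f"
    show "(\<integral>x. f x \<partial>distr \<mu> borel T) = (\<integral>x. f x \<partial>\<mu>)"
      using borel_measurable_continuous_onI[OF f] Tm eq[OF f] by (simp add: integral_distr)
  qed (use \<mu> in \<open>auto simp: prob_space.axioms\<close>)
  then show ?thesis
    using \<mu> by (simp add: invariant_measures_def)
qed

text \<open>
  Weak limit points of empirical measures are invariant: the averages of \<open>f \<circ> T\<close> and \<open>f\<close> over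
  \<open>n k\<close> steps differ by two boundary terms divided by \<open>n k\<close>.
\<close>

theorem empirical_cluster:
  fixes T :: "'a::metric_space \<Rightarrow> 'a"
  assumes X: "compact (UNIV :: 'a set)" and T: "continuous_on UNIV T" and n: "filterlim n at_top sequentially"
  obtains G \<mu> where "G \<le> sequentially" "G \<noteq> bot" "\<mu> \<in> invariant_measures T"
    "\<And>f. continuous_on UNIV f \<Longrightarrow> ((\<lambda>k. birkhoff_sum T f (n k) x / real (n k)) \<longlongrightarrow> (\<integral>x. f x \<partial>\<mu>)) G"
proof -
  have "\<forall>\<^sub>F k in sequentially. 0 < n k"
    using n eventually_gt_at_top[of 0] unfolding filterlim_iff by blast
  then have "\<forall>\<^sub>F k in sequentially. normalized_functional (\<lambda>f. birkhoff_sum T f (n k) x / real (n k))"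
    by eventually_elim (rule normalized_functional_birkhoff)
  from normalized_functionals_cluster[OF X this] obtain G \<mu>
    where G: "G \<le> sequentially" "G \<noteq> bot" and \<mu>: "prob_space \<mu>" "sets \<mu> = sets borel"
    and lim: "\<And>f. continuous_on UNIV f \<Longrightarrow> ((\<lambda>k. birkhoff_sum T f (n k) x / real (n k)) \<longlongrightarrow> (\<integral>x. f x \<partial>\<mu>)) G"
    by blast
  have "\<mu> \<in> invariant_measures T"
  proof (rule invariant_measuresI_continuous[OF T \<mu>])
    fix f :: "'a \<Rightarrow> real" assume f: "continuous_on UNIV f"
    have fT: "continuous_on UNIV (\<lambda>x. f (T x))"
      using continuous_on_compose2[OF f T] by simp
    obtain B where B: "0 < B" "\<And>x. \<bar>f x\<bar> \<le> B"
      using bounded_continuous[OF X f] by blast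
    have "(\<lambda>k. 2 * B / real (n k)) \<longlonglongrightarrow> 0"
      by (intro real_tendsto_divide_at_top[OF tendsto_const] filterlim_compose[OF filterlim_real_sequentially n])
    then have "((\<lambda>k. 2 * B / real (n k)) \<longlongrightarrow> 0) G"
      using G(1) by (rule tendsto_mono[rotated])
    then have "((\<lambda>k. birkhoff_sum T (\<lambda>x. f (T x)) (n k) x / real (n k) - birkhoff_sum T f (n k) x / real (n k)) \<longlongrightarrow> 0) G"
    proof (rule Lim_null_comparison[rotated], intro always_eventually allI)
      fix k
      have "birkhoff_sum T (\<lambda>x. f (T x)) m x - birkhoff_sum T f m x = f ((T ^^ m) x) - f x" for m
        by (induction m) (auto simp: birkhoff_sum_def)
      then have "\<bar>birkhoff_sum T (\<lambda>x. f (T x)) (n k) x - birkhoff_sum T f (n k) x\<bar> \<le> 2 * B"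
        using B(2)[of x] B(2)[of "(T ^^ n k) x"] by (simp add: abs_le_iff)
      then show "norm (birkhoff_sum T (\<lambda>x. f (T x)) (n k) x / real (n k) - birkhoff_sum T f (n k) x / real (n k)) \<le> 2 * B / real (n k)"
        by (simp add: diff_divide_distrib[symmetric] divide_right_mono)
    qed
    from tendsto_add[OF this lim[OF f]]
    have "(\<integral>x. f (T x) \<partial>\<mu>) = (\<integral>x. f x \<partial>\<mu>)"
      using tendsto_unique[OF G(2) lim[OF fT]] by simp
    then show "(\<integral>x. f (T x) \<partial>\<mu>) = (\<integral>x. f x \<partial>\<mu>)" .
  qed
  from that[OF G this lim] show ?thesis .
qed

section \<open>Projections of sets of full measure\<close>

lemma borel_closed_open_approximation:
  fixes \<mu> :: "'a::metric_space measure"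
  assumes \<mu>: "finite_measure \<mu>" "sets \<mu> = sets borel" and A: "A \<in> sets borel"
  shows "\<forall>e>0. \<exists>F U. closed F \<and> open U \<and> F \<subseteq> A \<and> A \<subseteq> U \<and> measure \<mu> (U - F) < e"
proof -
  interpret finite_measure \<mu> by fact
  have borel_\<mu>: "S \<in> sets \<mu>" if "closed S \<or> open S" for S :: "'a set"
    using that unfolding \<mu>(2) by (elim disjE) (rule borel_closed borel_open, assumption)+
  have "A \<in> sigma_sets UNIV (Collect closed)"
    using A by (simp add: borel_eq_closed)
  then show ?thesis
  proof induction
    case (Basic F)
    then have F: "closed F" by simp
    show ?case
    proof (cases "F = {}")
      case False
      show ?thesis
      proof (intro allI impI)
        fix e :: real assume e: "0 < e"
        define U where "U = (\<lambda>n::nat. {x. infdist x F < 1 / real (Suc n)})"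
        have U: "open (U n)" for n
          unfolding U_def by (intro open_Collect_less continuous_intros)
        have dec: "decseq (\<lambda>n. U n - F)"
          unfolding decseq_def U_def by (auto intro: less_le_trans simp: frac_le)
        have inter: "(\<Inter>n. U n - F) = {}"
        proof (rule ccontr)
          assume "(\<Inter>n. U n - F) \<noteq> {}"
          then obtain x where x: "\<And>n. x \<in> U n" "x \<notin> F" by blast
          then have "infdist x F > 0"
            using F False in_closed_iff_infdist_zero[of F x] infdist_nonneg[of x F] by force
          then obtain n where "1 / real (Suc n) < infdist x F"
            by (rule nat_approx_posE)
          with x(1)[of n] show False by (simp add: U_def)
        qed
        have "(\<lambda>n. measure \<mu> (U n - F)) \<longlonglongrightarrow> measure \<mu> (\<Inter>n. U n - F)"
          using U F borel_\<mu> by (intro finite_Lim_measure_decseq dec) auto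
        then have "(\<lambda>n. measure \<mu> (U n - F)) \<longlonglongrightarrow> 0"
          by (simp only: inter measure_empty)
        from order_tendstoD(2)[OF this e] obtain n where "measure \<mu> (U n - F) < e"
          by (auto simp: eventually_sequentially)
        moreover have "F \<subseteq> U n" by (auto simp: U_def)
        ultimately show "\<exists>G V. closed G \<and> open V \<and> G \<subseteq> F \<and> F \<subseteq> V \<and> measure \<mu> (V - G) < e"
          using F U by blast
      qed
    qed (auto intro!: exI[of _ "{}"])
  next
    case Empty
    show ?case by (auto intro!: exI[of _ "{}"])
  next
    case (Compl A)
    show ?case
    proof (intro allI impI)
      fix e :: real assume "0 < e"
      from Compl.IH[rule_format, OF this]
      obtain F U where FU: "closed F" "open U" "F \<subseteq> A" "A \<subseteq> U" "measure \<mu> (U - F) < e"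
        by (elim exE conjE)
      have "- F - (- U) = U - F" by blast
      with FU(5) have "measure \<mu> (- F - (- U)) < e" by (simp only:)
      moreover have "- U \<subseteq> UNIV - A" "UNIV - A \<subseteq> - F"
        using FU(3,4) by blast+
      moreover have "closed (- U)" "open (- F)"
        using FU(1,2) by (simp_all add: closed_Compl open_Compl)
      ultimately show "\<exists>F U. closed F \<and> open U \<and> F \<subseteq> UNIV - A \<and> UNIV - A \<subseteq> U \<and> measure \<mu> (U - F) < e"
        by blast
    qed
  next
    case (Union A)
    show ?case
    proof (intro allI impI)
      fix e :: real assume e: "0 < e"
      have "\<exists>F U. closed F \<and> open U \<and> F \<subseteq> A n \<and> A n \<subseteq> U \<and> measure \<mu> (U - F) < e / 2 * (1/2) ^ Suc n" for n
        by (rule Union.IH[rule_format]) (use e in simp)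
      then obtain F U where FU: "\<And>n. closed (F n)" "\<And>n. open (U n)" "\<And>n. F n \<subseteq> A n" "\<And>n. A n \<subseteq> U n"
        and small: "\<And>n. measure \<mu> (U n - F n) < e / 2 * (1/2) ^ Suc n"
        by metis
      define D where "D = (\<lambda>N. (\<Union>n. F n) - (\<Union>n<N. F n))"
      have F_Un: "(\<Union>n. F n) \<in> sets \<mu>" "(\<Union>n<N. F n) \<in> sets \<mu>" for N
        using FU borel_\<mu> by auto
      have geo: "(\<lambda>n. e / 2 * (1/2) ^ Suc n) sums (e / 2 * 1)"
        by (intro sums_mult power_half_series)
      have summ: "summable (\<lambda>n. measure \<mu> (U n - F n))"
        using small by (intro summable_comparison_test'[OF sums_summable[OF geo]]) (auto intro: less_imp_le)
      have "measure \<mu> (\<Union>n. U n - F n) \<le> (\<Sum>n. measure \<mu> (U n - F n))"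
        using FU borel_\<mu> by (intro finite_measure_subadditive_countably summ) auto
      also have "\<dots> \<le> e / 2"
        using suminf_le[OF less_imp_le[OF small] summ sums_summable[OF geo]] sums_unique[OF geo] by simp
      finally have first: "measure \<mu> (\<Union>n. U n - F n) \<le> e / 2" .
      have "(\<lambda>N. measure \<mu> (D N)) \<longlonglongrightarrow> measure \<mu> (\<Inter>N. D N)"
        using F_Un by (intro finite_Lim_measure_decseq) (auto simp: D_def decseq_def)
      moreover have "(\<Inter>N. D N) = {}" by (auto simp: D_def)
      ultimately have "(\<lambda>N. measure \<mu> (D N)) \<longlonglongrightarrow> 0" by simp
      from order_tendstoD(2)[OF this, of "e / 2"] e obtain N where N: "measure \<mu> (D N) < e / 2"
        by (auto simp: eventually_sequentially)
      have "(\<Union>n. U n - F n) \<in> sets \<mu>"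
        using FU borel_\<mu> by auto
      moreover have "D N \<in> sets \<mu>" using F_Un by (auto simp: D_def)
      ultimately have "measure \<mu> ((\<Union>n. U n) - (\<Union>n<N. F n)) \<le> measure \<mu> ((\<Union>n. U n - F n) \<union> D N)"
        by (intro finite_measure_mono) (auto simp: D_def)
      also have "\<dots> \<le> measure \<mu> (\<Union>n. U n - F n) + measure \<mu> (D N)"
        using \<open>(\<Union>n. U n - F n) \<in> sets \<mu>\<close> \<open>D N \<in> sets \<mu>\<close> by (rule measure_Un_le)
      also have "\<dots> < e" using first N by simp
      finally have "measure \<mu> ((\<Union>n. U n) - (\<Union>n<N. F n)) < e" .
      moreover have "closed (\<Union>n<N. F n)" "open (\<Union>n. U n)"
        using FU(1,2) by auto
      moreover have "(\<Union>n<N. F n) \<subseteq> (\<Union>n. A n)" "(\<Union>n. A n) \<subseteq> (\<Union>n. U n)"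
        by (rule UN_mono[OF subset_UNIV FU(3)], rule UN_mono[OF order_refl FU(4)])
      ultimately show "\<exists>F U. closed F \<and> open U \<and> F \<subseteq> (\<Union>n. A n) \<and> (\<Union>n. A n) \<subseteq> U \<and> measure \<mu> (U - F) < e"
        by blast
    qed
  qed
qed

text \<open>
  The projection of a Borel set need not be Borel, so the set of good pairs is first exhausted, up to a
  null set, by countably many closed sets; these are compact, and so are their projections.
\<close>

theorem AE_ex_fst:
  fixes \<kappa> :: "('a::metric_space \<times> 'b::metric_space) measure"
  assumes X: "compact (UNIV :: 'a set)" "compact (UNIV :: 'b set)"
    and \<kappa>: "prob_space \<kappa>" "sets \<kappa> = sets borel" and P: "AE z in \<kappa>. P z"
  shows "AE y in distr \<kappa> borel snd. \<exists>x. P (x, y)"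
proof -
  interpret prob_space \<kappa> by fact
  have sp: "space \<kappa> = UNIV" using sets_eq_imp_space_eq[OF \<kappa>(2)] by simp
  have XX: "compact (UNIV :: ('a \<times> 'b) set)"
    using compact_Times[OF X] by simp
  have snd_meas: "snd \<in> measurable \<kappa> borel"
    using borel_measurable_continuous_onI[OF continuous_on_snd[OF continuous_on_id, of UNIV]]
    by (simp add: measurable_cong_sets[OF \<kappa>(2)])
  obtain N where N: "{z \<in> space \<kappa>. \<not> P z} \<subseteq> N" "N \<in> null_sets \<kappa>"
    using P by (auto simp: eventually_ae_filter)
  then have A: "- N \<in> sets borel"
    using \<kappa> by (auto intro: borel_comp)
  have "\<exists>F. closed F \<and> F \<subseteq> - N \<and> measure \<kappa> (- F) < 1 / Suc k" for k :: nat
  proof -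
    obtain F U where FU: "closed F" "open U" "F \<subseteq> - N" "- N \<subseteq> U" "measure \<kappa> (U - F) < 1 / Suc k"
      using borel_closed_open_approximation[OF finite_measure_axioms \<kappa>(2) A, rule_format, of "1 / Suc k"] by auto
    have "measure \<kappa> (- F) = measure \<kappa> (U - F)"
    proof (rule measure_eq_AE)
      show "AE z in \<kappa>. z \<in> - F \<longleftrightarrow> z \<in> U - F"
        using AE_not_in[OF N(2)] by eventually_elim (use FU in auto)
      show "- F \<in> sets \<kappa>" "U - F \<in> sets \<kappa>" using FU \<kappa> by auto
    qed
    with FU show ?thesis by auto
  qed
  then obtain F where F: "\<And>k. closed (F k)" "\<And>k. F k \<subseteq> - N" "\<And>k. measure \<kappa> (- F k) < 1 / Suc k"
    by metis
  define Y where "Y = (\<Union>k. snd ` F k)"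
  have "closed (snd ` F k)" for k
  proof -
    have "compact (F k)"
      using XX F(1)[of k] by (metis closed_Int_compact inf_top_right)
    then show ?thesis
      by (intro compact_imp_closed compact_continuous_image continuous_on_snd continuous_on_id)
  qed
  then have Y: "Y \<in> sets borel"
    by (auto simp: Y_def)
  have Y_P: "\<exists>x. P (x, y)" if y: "y \<in> Y" for y
  proof -
    obtain k z where z: "z \<in> F k" "y = snd z" using y unfolding Y_def by blast
    then have "P z" using F(2)[of k] N(1) by (auto simp: sp)
    then show ?thesis using z by (metis prod.collapse)
  qed
  have vim: "snd -` (- Y) \<in> sets \<kappa>"
    using measurable_sets[OF snd_meas, of "- Y"] Y by (simp add: sp borel_comp)
  have "measure \<kappa> (snd -` (- Y)) = 0"
  proof (rule ccontr)
    assume "measure \<kappa> (snd -` (- Y)) \<noteq> 0"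
    then have "0 < measure \<kappa> (snd -` (- Y))" by (simp add: zero_less_measure_iff)
    then obtain k where k: "1 / real (Suc k) < measure \<kappa> (snd -` (- Y))"
      by (rule nat_approx_posE)
    have "measure \<kappa> (snd -` (- Y)) \<le> measure \<kappa> (- F k)"
      using F(1)[of k] \<kappa> by (intro finite_measure_mono) (auto simp: Y_def)
    with k F(3)[of k] show False by simp
  qed
  then have "AE z in \<kappa>. z \<notin> snd -` (- Y)"
    using vim by (intro AE_not_in null_setsI) (simp_all add: emeasure_eq_measure)
  then have "AE z in \<kappa>. snd z \<in> Y" by simp
  then have "AE y in distr \<kappa> borel snd. y \<in> Y"
    using Y by (subst AE_distr_iff[OF snd_meas]) auto
  then show ?thesis
    by eventually_elim (rule Y_P)
qed

section \<open>Joinings\<close>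

definition pair_dist :: "'a::metric_space \<times> 'a \<Rightarrow> real" where
  "pair_dist z = dist (fst z) (snd z)"

lemma continuous_pair_dist: "continuous_on UNIV pair_dist"
  unfolding pair_dist_def by (intro continuous_intros)

lemma continuous_map_prod:
  assumes "continuous_on UNIV T"
  shows "continuous_on UNIV (map_prod T T)"
  unfolding map_prod_def split_beta
  by (intro continuous_intros continuous_on_compose2[OF assms]) auto

lemma funpow_map_prod:
  fixes T :: "'a \<Rightarrow> 'a" and S :: "'b \<Rightarrow> 'b"
  shows "(map_prod T S ^^ j) (x, y) = ((T ^^ j) x, (S ^^ j) y)"
  by (induction j) auto

lemma birkhoff_sum_fst:
  fixes T :: "'a \<Rightarrow> 'a" and S :: "'b \<Rightarrow> 'b"
  shows "birkhoff_sum (map_prod T S) (\<lambda>z. f (fst z)) n (x, y) = birkhoff_sum T f n x"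
  by (simp add: birkhoff_sum_def funpow_map_prod)

lemma birkhoff_sum_snd:
  fixes T :: "'a \<Rightarrow> 'a" and S :: "'b \<Rightarrow> 'b"
  shows "birkhoff_sum (map_prod T S) (\<lambda>z. f (snd z)) n (x, y) = birkhoff_sum S f n y"
  by (simp add: birkhoff_sum_def funpow_map_prod)

lemma orbit_dist_avg_eq_birkhoff:
  "orbit_dist_avg T x y n = birkhoff_sum (map_prod T T) pair_dist n (x, y) / real n"
  by (simp add: orbit_dist_avg_def birkhoff_sum_def funpow_map_prod pair_dist_def)

lemma orbit_dist_avg_commute: "orbit_dist_avg T x y n = orbit_dist_avg T y x n"
  by (simp add: orbit_dist_avg_def dist_commute)

lemma measurable_fst_snd:
  fixes \<kappa> :: "('a::metric_space \<times> 'a) measure"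
  assumes "sets \<kappa> = sets borel"
  shows "fst \<in> measurable \<kappa> borel" "snd \<in> measurable \<kappa> borel"
  using borel_measurable_continuous_onI[OF continuous_on_fst[OF continuous_on_id, of UNIV]]
    borel_measurable_continuous_onI[OF continuous_on_snd[OF continuous_on_id, of UNIV]]
  by (simp_all add: measurable_cong_sets[OF assms])

lemma joiningsD:
  fixes \<mu> \<nu> :: "'a::metric_space measure"
  assumes "\<kappa> \<in> joinings T \<mu> \<nu>"
  shows "\<kappa> \<in> invariant_measures (map_prod T T)" "prob_space \<kappa>" "sets \<kappa> = sets borel" "space \<kappa> = UNIV"
    "distr \<kappa> borel fst = \<mu>" "distr \<kappa> borel snd = \<nu>"
  using assms invariant_measuresD[of \<kappa> "map_prod T T"] by (auto simp: joinings_def)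

lemma joining_integral:
  fixes \<mu> \<nu> :: "'a::metric_space measure" and g :: "'a \<Rightarrow> real"
  assumes "\<kappa> \<in> joinings T \<mu> \<nu>" "g \<in> borel_measurable borel"
  shows "(\<integral>z. g (fst z) \<partial>\<kappa>) = (\<integral>x. g x \<partial>\<mu>)" "(\<integral>z. g (snd z) \<partial>\<kappa>) = (\<integral>x. g x \<partial>\<nu>)"
  using joiningsD[OF assms(1)] measurable_fst_snd[of \<kappa>] assms(2)
  by (metis integral_distr)+

lemma joining_AE:
  fixes \<mu> \<nu> :: "'a::metric_space measure"
  assumes "\<kappa> \<in> joinings T \<mu> \<nu>"
  shows "AE x in \<mu>. P x \<Longrightarrow> AE z in \<kappa>. P (fst z)" "AE x in \<nu>. P x \<Longrightarrow> AE z in \<kappa>. P (snd z)"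
  using joiningsD[OF assms] measurable_fst_snd[of \<kappa>] by (metis AE_distrD)+

lemma joiningsI_continuous:
  fixes T :: "'a::metric_space \<Rightarrow> 'a"
  assumes \<kappa>: "\<kappa> \<in> invariant_measures (map_prod T T)"
    and \<mu>: "\<mu> \<in> invariant_measures T" and \<nu>: "\<nu> \<in> invariant_measures T"
    and fst: "\<And>f :: 'a \<Rightarrow> real. continuous_on UNIV f \<Longrightarrow> (\<integral>z. f (fst z) \<partial>\<kappa>) = (\<integral>x. f x \<partial>\<mu>)"
    and snd: "\<And>f :: 'a \<Rightarrow> real. continuous_on UNIV f \<Longrightarrow> (\<integral>z. f (snd z) \<partial>\<kappa>) = (\<integral>x. f x \<partial>\<nu>)"
  shows "\<kappa> \<in> joinings T \<mu> \<nu>"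
proof -
  interpret prob_space \<kappa> by (rule invariant_measuresD(1)[OF \<kappa>])
  note m = measurable_fst_snd[OF invariant_measuresD(2)[OF \<kappa>]]
  have "distr \<kappa> borel p = \<rho>" if p: "p \<in> measurable \<kappa> borel" and \<rho>: "\<rho> \<in> invariant_measures T"
    and eq: "\<And>f :: 'a \<Rightarrow> real. continuous_on UNIV f \<Longrightarrow> (\<integral>z. f (p z) \<partial>\<kappa>) = (\<integral>x. f x \<partial>\<rho>)" for p \<rho>
  proof (rule borel_measure_eqI)
    show "finite_measure (distr \<kappa> borel p)"
      using prob_space_distr[OF p] by (simp add: prob_space.axioms)
    show "finite_measure \<rho>"
      using invariant_measuresD(1)[OF \<rho>] by (simp add: prob_space.axioms)
    fix f :: "'a \<Rightarrow> real" assume f: "continuous_on UNIV f"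
    show "(\<integral>x. f x \<partial>distr \<kappa> borel p) = (\<integral>x. f x \<partial>\<rho>)"
      using borel_measurable_continuous_onI[OF f] p eq[OF f] by (simp add: integral_distr)
  qed (simp_all add: invariant_measuresD(2)[OF \<rho>])
  from this[OF m(1) \<mu> fst] this[OF m(2) \<nu> snd] show ?thesis
    using \<kappa> by (simp add: joinings_def)
qed

text \<open>
  The independent joining, obtained from the functional \<open>f \<mapsto> \<integral>\<integral> f (x, y) d\<nu>(y) d\<mu>(x)\<close> on continuous
  functions. It makes \<^const>\<open>rho_bar\<close> an infimum over a nonempty set; over the empty set the
  real-valued infimum would carry no information.
\<close>

lemma joinings_nonempty:
  fixes T :: "'a::metric_space \<Rightarrow> 'a"
  assumes X: "compact (UNIV :: 'a set)" and T: "continuous_on UNIV T"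
    and \<mu>: "\<mu> \<in> invariant_measures T" and \<nu>: "\<nu> \<in> invariant_measures T"
  shows "joinings T \<mu> \<nu> \<noteq> {}"
proof -
  note M = invariant_measuresD[OF \<mu>] and N = invariant_measuresD[OF \<nu>]
  interpret M: prob_space \<mu> by (rule M(1))
  interpret N: prob_space \<nu> by (rule N(1))
  have XX: "compact (UNIV :: ('a \<times> 'a) set)"
    using compact_Times[OF X X] by simp
  have Tm: "T \<in> borel \<rightarrow>\<^sub>M borel" by (rule borel_measurable_continuous_onI[OF T])
  define J where "J = (\<lambda>(f :: 'a \<times> 'a \<Rightarrow> real) x. \<integral>y. f (x, y) \<partial>\<nu>)"
  have sec: "continuous_on UNIV (\<lambda>y. f (x, y))" if "continuous_on UNIV f" for f :: "'a \<times> 'a \<Rightarrow> real" and x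
    by (rule continuous_on_compose2[OF that]) (auto intro!: continuous_intros)
  have int_sec: "integrable \<nu> (\<lambda>y. f (x, y))" if "continuous_on UNIV f" for f :: "'a \<times> 'a \<Rightarrow> real" and x
    by (rule continuous_integrable[OF X N(1,2) sec[OF that]])
  have J_cont: "continuous_on UNIV (J f)" if f: "continuous_on UNIV f" for f
  proof (rule continuous_onI)
    fix x :: 'a and e :: real assume e: "0 < e"
    obtain d where d: "0 < d" "\<And>z w. dist z w < d \<Longrightarrow> \<bar>f z - f w\<bar> < e"
      using uniform_modulus[OF XX f e] by blast
    have "dist (J f x') (J f x) \<le> e" if x': "dist x' x < d" for x'
    proof -
      have "\<bar>f (x', y) - f (x, y)\<bar> \<le> e" for y
        using d(2)[of "(x', y)" "(x, y)"] x' by (simp add: dist_Pair_Pair)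
      then have "(\<integral>y. \<bar>f (x', y) - f (x, y)\<bar> \<partial>\<nu>) \<le> (\<integral>y. e \<partial>\<nu>)"
        using int_sec[OF f] by (intro integral_mono) auto
      then show ?thesis
        using integral_abs_bound[of \<nu> "\<lambda>y. f (x', y) - f (x, y)"] int_sec[OF f]
        by (simp add: J_def dist_real_def N.prob_space)
    qed
    then show "\<exists>d>0. \<forall>x'\<in>UNIV. dist x' x < d \<longrightarrow> dist (J f x') (J f x) \<le> e"
      using d(1) by blast
  qed
  have "normalized_functional (\<lambda>f. \<integral>x. J f x \<partial>\<mu>)"
  proof
    fix f g :: "'a \<times> 'a \<Rightarrow> real" and c :: real
    assume f: "continuous_on UNIV f"
    show "(\<integral>x. J (\<lambda>z. f z + g z) x \<partial>\<mu>) = (\<integral>x. J f x \<partial>\<mu>) + (\<integral>x. J g x \<partial>\<mu>)" if g: "continuous_on UNIV g"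
    proof -
      have "J (\<lambda>z. f z + g z) = (\<lambda>x. J f x + J g x)"
        using int_sec[OF f] int_sec[OF g] by (simp add: J_def)
      then show ?thesis
        using continuous_integrable[OF X M(1,2) J_cont[OF f]] continuous_integrable[OF X M(1,2) J_cont[OF g]]
        by simp
    qed
    show "(\<integral>x. J (\<lambda>z. c * f z) x \<partial>\<mu>) = c * (\<integral>x. J f x \<partial>\<mu>)"
      by (simp add: J_def)
    show "0 \<le> (\<integral>x. J f x \<partial>\<mu>)" if "\<And>z. 0 \<le> f z"
      using that by (simp add: J_def)
  next
    show "(\<integral>x. J (\<lambda>z. 1) x \<partial>\<mu>) = 1"
      by (simp add: J_def N.prob_space M.prob_space)
  qed
  from riesz_representation[OF XX this] obtain \<kappa>
    where \<kappa>: "prob_space \<kappa>" "sets \<kappa> = sets borel"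
    and int_\<kappa>: "\<And>f. continuous_on UNIV f \<Longrightarrow> (\<integral>z. f z \<partial>\<kappa>) = (\<integral>x. J f x \<partial>\<mu>)"
    by blast
  have "\<kappa> \<in> invariant_measures (map_prod T T)"
  proof (rule invariant_measuresI_continuous[OF continuous_map_prod[OF T] \<kappa>])
    fix f :: "'a \<times> 'a \<Rightarrow> real" assume f: "continuous_on UNIV f"
    have fT: "continuous_on UNIV (\<lambda>z. f (map_prod T T z))"
      by (rule continuous_on_compose2[OF f continuous_map_prod[OF T]]) simp
    have "J (\<lambda>z. f (map_prod T T z)) x = J f (T x)" for x
      unfolding J_def
      using invariant_integral[OF \<nu> Tm borel_measurable_continuous_onI[OF sec[OF f, of "T x"]]] by simp
    then have "(\<integral>z. f (map_prod T T z) \<partial>\<kappa>) = (\<integral>x. J f (T x) \<partial>\<mu>)"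
      by (simp add: int_\<kappa>[OF fT])
    also have "\<dots> = (\<integral>z. f z \<partial>\<kappa>)"
      using invariant_integral[OF \<mu> Tm borel_measurable_continuous_onI[OF J_cont[OF f]]]
      by (simp add: int_\<kappa>[OF f])
    finally show "(\<integral>z. f (map_prod T T z) \<partial>\<kappa>) = (\<integral>z. f z \<partial>\<kappa>)" .
  qed
  then have "\<kappa> \<in> joinings T \<mu> \<nu>"
  proof (rule joiningsI_continuous[OF _ \<mu> \<nu>])
    fix f :: "'a \<Rightarrow> real" assume f: "continuous_on UNIV f"
    have "continuous_on UNIV (\<lambda>z::'a \<times> 'a. f (fst z))" "continuous_on UNIV (\<lambda>z::'a \<times> 'a. f (snd z))"
      by (intro continuous_on_compose2[OF f] continuous_intros; simp)+
    then show "(\<integral>z. f (fst z) \<partial>\<kappa>) = (\<integral>x. f x \<partial>\<mu>)" "(\<integral>z. f (snd z) \<partial>\<kappa>) = (\<integral>x. f x \<partial>\<nu>)"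
      by (simp_all add: int_\<kappa> J_def N.prob_space M.prob_space)
  qed
  then show ?thesis by blast
qed

section \<open>Optimal joinings\<close>

lemma rho_bar_le:
  assumes "\<kappa> \<in> joinings T \<mu> \<nu>"
  shows "rho_bar T \<mu> \<nu> \<le> (\<integral>z. pair_dist z \<partial>\<kappa>)"
  unfolding rho_bar_def pair_dist_def
  by (rule cINF_lower[OF _ assms]) (auto intro!: bdd_belowI2[of _ 0] integral_nonneg)

lemma rho_bar_nonneg:
  assumes "joinings T \<mu> \<nu> \<noteq> {}"
  shows "0 \<le> rho_bar T \<mu> \<nu>"
  unfolding rho_bar_def by (rule cINF_greatest[OF assms]) (auto intro!: integral_nonneg)

text \<open>
  The set of joinings is weakly closed and the cost is weakly continuous, so a weak limit point of a
  minimizing sequence attains the infimum.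
\<close>

theorem optimal_joining:
  fixes T :: "'a::metric_space \<Rightarrow> 'a"
  assumes X: "compact (UNIV :: 'a set)" and T: "continuous_on UNIV T"
    and \<mu>: "\<mu> \<in> invariant_measures T" and \<nu>: "\<nu> \<in> invariant_measures T"
  obtains \<kappa> where "\<kappa> \<in> joinings T \<mu> \<nu>" "(\<integral>z. pair_dist z \<partial>\<kappa>) = rho_bar T \<mu> \<nu>"
proof -
  have XX: "compact (UNIV :: ('a \<times> 'a) set)"
    using compact_Times[OF X X] by simp
  note ne = joinings_nonempty[OF X T \<mu> \<nu>]
  have "\<exists>\<kappa>\<in>joinings T \<mu> \<nu>. (\<integral>z. pair_dist z \<partial>\<kappa>) < rho_bar T \<mu> \<nu> + 1 / real (Suc k)" for k
  proof -
    have "rho_bar T \<mu> \<nu> < rho_bar T \<mu> \<nu> + 1 / real (Suc k)" by simp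
    then show ?thesis
      unfolding rho_bar_def pair_dist_def
      by (subst (asm) cINF_less_iff[OF ne]) (auto intro!: bdd_belowI2[of _ 0] integral_nonneg)
  qed
  then obtain K where K: "\<And>k. K k \<in> joinings T \<mu> \<nu>"
    and K_cost: "\<And>k. (\<integral>z. pair_dist z \<partial>K k) < rho_bar T \<mu> \<nu> + 1 / real (Suc k)"
    by metis
  define \<Lambda> where "\<Lambda> = (\<lambda>k (f :: 'a \<times> 'a \<Rightarrow> real). \<integral>z. f z \<partial>K k)"
  have "\<forall>\<^sub>F k in sequentially. normalized_functional (\<Lambda> k)"
    using normalized_functional_integral[OF XX joiningsD(2,3)[OF K]] by (simp add: \<Lambda>_def)
  from normalized_functionals_cluster[OF XX this] obtain G \<kappa>
    where G: "G \<le> sequentially" "G \<noteq> bot" and \<kappa>: "prob_space \<kappa>" "sets \<kappa> = sets borel"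
    and lim_\<Lambda>: "\<And>f. continuous_on UNIV f \<Longrightarrow> ((\<lambda>k. \<Lambda> k f) \<longlongrightarrow> (\<integral>z. f z \<partial>\<kappa>)) G"
    by blast
  note lim = lim_\<Lambda>[unfolded \<Lambda>_def]
  note TT = continuous_map_prod[OF T]
  have "\<kappa> \<in> invariant_measures (map_prod T T)"
  proof (rule invariant_measuresI_continuous[OF TT \<kappa>])
    fix f :: "'a \<times> 'a \<Rightarrow> real" assume f: "continuous_on UNIV f"
    have fT: "continuous_on UNIV (\<lambda>z. f (map_prod T T z))"
      by (rule continuous_on_compose2[OF f TT]) simp
    have "(\<integral>z. f (map_prod T T z) \<partial>K k) = (\<integral>z. f z \<partial>K k)" for k
      by (rule invariant_integral[OF joiningsD(1)[OF K] borel_measurable_continuous_onI[OF TT]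
            borel_measurable_continuous_onI[OF f]])
    then show "(\<integral>z. f (map_prod T T z) \<partial>\<kappa>) = (\<integral>z. f z \<partial>\<kappa>)"
      using tendsto_unique[OF G(2) lim[OF fT]] lim[OF f] by simp
  qed
  then have "\<kappa> \<in> joinings T \<mu> \<nu>"
  proof (rule joiningsI_continuous[OF _ \<mu> \<nu>])
    fix f :: "'a \<Rightarrow> real" assume f: "continuous_on UNIV f"
    have ff: "continuous_on UNIV (\<lambda>z::'a \<times> 'a. f (fst z))" "continuous_on UNIV (\<lambda>z::'a \<times> 'a. f (snd z))"
      by (intro continuous_on_compose2[OF f] continuous_intros; simp)+
    note eq = joining_integral[OF K borel_measurable_continuous_onI[OF f]]
    show "(\<integral>z. f (fst z) \<partial>\<kappa>) = (\<integral>x. f x \<partial>\<mu>)"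
      using tendsto_unique[OF G(2) lim[OF ff(1)], of "\<integral>x. f x \<partial>\<mu>"] by (simp add: eq)
    show "(\<integral>z. f (snd z) \<partial>\<kappa>) = (\<integral>x. f x \<partial>\<nu>)"
      using tendsto_unique[OF G(2) lim[OF ff(2)], of "\<integral>x. f x \<partial>\<nu>"] by (simp add: eq)
  qed
  moreover have "(\<integral>z. pair_dist z \<partial>\<kappa>) = rho_bar T \<mu> \<nu>"
  proof (rule tendsto_unique[OF G(2) lim[OF continuous_pair_dist]])
    have "(\<lambda>k. \<integral>z. pair_dist z \<partial>K k) \<longlonglongrightarrow> rho_bar T \<mu> \<nu>"
    proof (rule tendsto_sandwich[OF _ _ tendsto_const])
      show "\<forall>\<^sub>F k in sequentially. rho_bar T \<mu> \<nu> \<le> (\<integral>z. pair_dist z \<partial>K k)"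
        by (intro always_eventually allI rho_bar_le K)
      show "\<forall>\<^sub>F k in sequentially. (\<integral>z. pair_dist z \<partial>K k) \<le> rho_bar T \<mu> \<nu> + 1 / real (Suc k)"
        by (intro always_eventually allI less_imp_le K_cost)
      show "(\<lambda>k. rho_bar T \<mu> \<nu> + 1 / real (Suc k)) \<longlonglongrightarrow> rho_bar T \<mu> \<nu>"
        using tendsto_add[OF tendsto_const LIMSEQ_Suc[OF lim_1_over_n], of "rho_bar T \<mu> \<nu>"] by simp
    qed
    then show "((\<lambda>k. \<integral>z. pair_dist z \<partial>K k) \<longlongrightarrow> rho_bar T \<mu> \<nu>) G"
      using G(1) by (rule tendsto_mono[rotated])
  qed
  ultimately show ?thesis using that by blast
qed

text \<open>
  The empirical measures of \<open>(x, y)\<close> along the times at which the averaged distance is at most \<open>c\<close>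
  have a weak limit point. It is a joining because its marginals are the limits along \<open>x\<close> and \<open>y\<close>,
  and its cost is at most \<open>c\<close>.
\<close>

theorem rho_bar_le_of_frequently:
  fixes T :: "'a::metric_space \<Rightarrow> 'a"
  assumes X: "compact (UNIV :: 'a set)" and T: "continuous_on UNIV T"
    and \<mu>: "\<mu> \<in> invariant_measures T" and \<nu>: "\<nu> \<in> invariant_measures T"
    and n: "filterlim n at_top sequentially"
    and x: "quasi_generic T n \<mu> x" and y: "quasi_generic T n \<nu> y"
    and freq: "\<exists>\<^sub>F k in sequentially. orbit_dist_avg T x y (n k) \<le> c"
  shows "rho_bar T \<mu> \<nu> \<le> c"
proof -
  have XX: "compact (UNIV :: ('a \<times> 'a) set)"
    using compact_Times[OF X X] by simp
  obtain r :: "nat \<Rightarrow> nat" where r: "strict_mono r" and le: "\<And>k. orbit_dist_avg T x y (n (r k)) \<le> c"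
    using not_eventually_sequentiallyD[of "\<lambda>k. \<not> orbit_dist_avg T x y (n k) \<le> c"] freq
    by (auto simp: frequently_def)
  have nr: "filterlim (\<lambda>k. n (r k)) at_top sequentially"
    by (rule filterlim_compose[OF n filterlim_subseq[OF r]])
  from empirical_cluster[OF XX continuous_map_prod[OF T] nr, of "(x, y)"] obtain G \<kappa>
    where G: "G \<le> sequentially" "G \<noteq> bot" and \<kappa>: "\<kappa> \<in> invariant_measures (map_prod T T)"
    and lim: "\<And>f. continuous_on UNIV f \<Longrightarrow>
      ((\<lambda>k. birkhoff_sum (map_prod T T) f (n (r k)) (x, y) / real (n (r k))) \<longlongrightarrow> (\<integral>z. f z \<partial>\<kappa>)) G"
    by blast
  have sub: "((\<lambda>k. g (r k)) \<longlongrightarrow> l) G" if "g \<longlonglongrightarrow> l" for g :: "nat \<Rightarrow> real" and l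
    using LIMSEQ_subseq_LIMSEQ[OF that r] G(1) unfolding comp_def by (rule tendsto_mono[rotated])
  have "\<kappa> \<in> joinings T \<mu> \<nu>"
  proof (rule joiningsI_continuous[OF \<kappa> \<mu> \<nu>])
    fix f :: "'a \<Rightarrow> real" assume f: "continuous_on UNIV f"
    have ff: "continuous_on UNIV (\<lambda>z::'a \<times> 'a. f (fst z))" "continuous_on UNIV (\<lambda>z::'a \<times> 'a. f (snd z))"
      by (intro continuous_on_compose2[OF f] continuous_intros; simp)+
    have "(\<lambda>k. birkhoff_sum T f (n k) x / real (n k)) \<longlonglongrightarrow> (\<integral>x. f x \<partial>\<mu>)"
      using x f quasi_generic_iff_real[OF X invariant_measuresD(1,2)[OF \<mu>]] by blast
    from tendsto_unique[OF G(2) lim[OF ff(1)]] sub[OF this]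
    show "(\<integral>z. f (fst z) \<partial>\<kappa>) = (\<integral>x. f x \<partial>\<mu>)"
      by (simp add: birkhoff_sum_fst)
    have "(\<lambda>k. birkhoff_sum T f (n k) y / real (n k)) \<longlonglongrightarrow> (\<integral>x. f x \<partial>\<nu>)"
      using y f quasi_generic_iff_real[OF X invariant_measuresD(1,2)[OF \<nu>]] by blast
    from tendsto_unique[OF G(2) lim[OF ff(2)]] sub[OF this]
    show "(\<integral>z. f (snd z) \<partial>\<kappa>) = (\<integral>x. f x \<partial>\<nu>)"
      by (simp add: birkhoff_sum_snd)
  qed
  then have "rho_bar T \<mu> \<nu> \<le> (\<integral>z. pair_dist z \<partial>\<kappa>)"
    by (rule rho_bar_le)
  also have "\<dots> \<le> c"
    by (rule tendsto_upperbound[OF lim[OF continuous_pair_dist] _ G(2)])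
      (use le in \<open>simp add: orbit_dist_avg_eq_birkhoff\<close>)
  finally show ?thesis .
qed

text \<open>
  Along almost every pair of an optimal joining the averaged distances are asymptotically bounded below
  by the mean distance, so that they converge to it.
\<close>

theorem AE_optimal_generic:
  fixes T :: "'a::metric_space \<Rightarrow> 'a"
  assumes X: "compact (UNIV :: 'a set)" and T: "continuous_on UNIV T"
    and \<mu>: "ergodic_measure T \<mu>" and \<nu>: "ergodic_measure T \<nu>"
  shows "AE y in \<nu>. \<exists>x. x \<in> Gen T \<mu> \<and> orbit_dist_avg T x y \<longlonglongrightarrow> rho_bar T \<mu> \<nu>"
proof -
  have inv: "\<mu> \<in> invariant_measures T" "\<nu> \<in> invariant_measures T"
    using \<mu> \<nu> by (simp_all add: ergodic_measure_def)
  have XX: "compact (UNIV :: ('a \<times> 'a) set)"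
    using compact_Times[OF X X] by simp
  obtain \<kappa> where \<kappa>: "\<kappa> \<in> joinings T \<mu> \<nu>" and cost: "(\<integral>z. pair_dist z \<partial>\<kappa>) = rho_bar T \<mu> \<nu>"
    by (rule optimal_joining[OF X T inv])
  note D = joiningsD[OF \<kappa>]
  obtain B where B: "\<And>z :: 'a \<times> 'a. \<bar>pair_dist z\<bar> \<le> B"
    using bounded_continuous[OF XX continuous_pair_dist] by blast
  have gen: "AE z in \<kappa>. fst z \<in> Gen T \<mu>" "AE z in \<kappa>. snd z \<in> Gen T \<nu>"
    by (rule joining_AE[OF \<kappa>] AE_generic[OF X T] \<mu> \<nu>)+
  have "AE z in \<kappa>. (\<lambda>n. birkhoff_sum (map_prod T T) pair_dist n z / real n) \<longlonglongrightarrow> (\<integral>z. pair_dist z \<partial>\<kappa>)"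
  proof (rule birkhoff_of_lower_bound[OF D(1) _ _ B])
    show "map_prod T T \<in> borel \<rightarrow>\<^sub>M borel" "pair_dist \<in> borel_measurable borel"
      by (intro borel_measurable_continuous_onI continuous_map_prod T continuous_pair_dist)+
    show "AE z in \<kappa>. \<forall>c<\<integral>z. pair_dist z \<partial>\<kappa>.
        \<forall>\<^sub>F n in sequentially. real n * c < birkhoff_sum (map_prod T T) pair_dist n z"
      using gen
    proof eventually_elim
      case (elim z)
      show ?case
      proof (intro allI impI)
        fix c assume "c < (\<integral>z. pair_dist z \<partial>\<kappa>)"
        then have "\<not> rho_bar T \<mu> \<nu> \<le> c" by (simp add: cost)
        then have "\<not> (\<exists>\<^sub>F n in sequentially. orbit_dist_avg T (fst z) (snd z) n \<le> c)"
          using rho_bar_le_of_frequently[OF X T inv filterlim_ident, of "fst z" "snd z" c] elim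
          by (auto simp: Gen_def)
        then have "\<forall>\<^sub>F n in sequentially. c < orbit_dist_avg T (fst z) (snd z) n"
          by (simp add: not_frequently not_le)
        then show "\<forall>\<^sub>F n in sequentially. real n * c < birkhoff_sum (map_prod T T) pair_dist n z"
          using eventually_gt_at_top[of 0]
          by eventually_elim (simp add: orbit_dist_avg_eq_birkhoff field_simps)
      qed
    qed
  qed
  with gen(1) have "AE z in \<kappa>. fst z \<in> Gen T \<mu> \<and> orbit_dist_avg T (fst z) (snd z) \<longlonglongrightarrow> rho_bar T \<mu> \<nu>"
    by eventually_elim (simp add: orbit_dist_avg_eq_birkhoff[abs_def] cost)
  from AE_ex_fst[OF X X D(2,3) this, unfolded D(6)] show ?thesis
    by simp
qed

section \<open>Ergodicity passes to limits of ergodic measures\<close>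

lemma joining_integral_diff:
  fixes T :: "'a::metric_space \<Rightarrow> 'a" and f :: "'a \<Rightarrow> real"
  assumes X: "compact (UNIV :: 'a set)" and \<kappa>: "\<kappa> \<in> joinings T \<mu> \<nu>"
    and f: "continuous_on UNIV f" and C: "\<And>x y. \<bar>f x - f y\<bar> \<le> e + C * dist x y"
  shows "(\<integral>z. \<bar>f (fst z) - f (snd z)\<bar> \<partial>\<kappa>) \<le> e + C * (\<integral>z. pair_dist z \<partial>\<kappa>)"
    and "integrable \<kappa> (\<lambda>z. \<bar>f (fst z) - f (snd z)\<bar>)"
proof -
  note D = joiningsD[OF \<kappa>]
  interpret prob_space \<kappa> by (rule D(2))
  have XX: "compact (UNIV :: ('a \<times> 'a) set)"
    using compact_Times[OF X X] by simp
  note int = continuous_integrable[OF XX D(2,3)]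
  have ff: "continuous_on UNIV (\<lambda>z::'a \<times> 'a. f (fst z))" "continuous_on UNIV (\<lambda>z::'a \<times> 'a. f (snd z))"
    by (intro continuous_on_compose2[OF f] continuous_intros; simp)+
  show 1: "integrable \<kappa> (\<lambda>z. \<bar>f (fst z) - f (snd z)\<bar>)"
    by (intro int continuous_intros ff)
  have 2: "integrable \<kappa> pair_dist" by (intro int continuous_pair_dist)
  have "(\<integral>z. \<bar>f (fst z) - f (snd z)\<bar> \<partial>\<kappa>) \<le> (\<integral>z. e + C * pair_dist z \<partial>\<kappa>)"
  proof (rule integral_mono[OF 1])
    show "integrable \<kappa> (\<lambda>z. e + C * pair_dist z)" using 2 by simp
  qed (use C in \<open>simp add: pair_dist_def\<close>)
  also have "\<dots> = e + C * (\<integral>z. pair_dist z \<partial>\<kappa>)"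
    using 2 by (simp add: prob_space)
  finally show "(\<integral>z. \<bar>f (fst z) - f (snd z)\<bar> \<partial>\<kappa>) \<le> e + C * (\<integral>z. pair_dist z \<partial>\<kappa>)" .
qed

text \<open>
  The joinings \<open>\<kappa> m\<close> are optimal and therefore concentrate on the diagonal, where \<open>f\<close> takes the same
  value on both coordinates. The factor \<open>g\<close> is merely bounded and measurable, as it will be the indicator
  of an invariant set.
\<close>

lemma joinings_integral_tendsto:
  fixes T :: "'a::metric_space \<Rightarrow> 'a" and f :: "'a \<Rightarrow> real"
  assumes X: "compact (UNIV :: 'a set)" and T: "continuous_on UNIV T"
    and M: "\<And>m. M m \<in> invariant_measures T" and \<mu>: "\<mu> \<in> invariant_measures T"
    and lim: "(\<lambda>m. rho_bar T (M m) \<mu>) \<longlonglongrightarrow> 0" and f: "continuous_on UNIV f"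
    and g: "g \<in> borel_measurable borel" and g1: "\<And>x. \<bar>g x\<bar> \<le> 1"
  shows "\<exists>\<kappa>. (\<forall>m. \<kappa> m \<in> joinings T (M m) \<mu>) \<and>
     (\<lambda>m. \<integral>z. f (fst z) * g (snd z) \<partial>\<kappa> m) \<longlonglongrightarrow> (\<integral>x. f x * g x \<partial>\<mu>)"
proof -
  have XX: "compact (UNIV :: ('a \<times> 'a) set)"
    using compact_Times[OF X X] by simp
  have "\<exists>\<kappa>\<in>joinings T (M m) \<mu>. (\<integral>z. pair_dist z \<partial>\<kappa>) = rho_bar T (M m) \<mu>" for m
    using optimal_joining[OF X T M \<mu>] by metis
  then obtain \<kappa> where \<kappa>: "\<And>m. \<kappa> m \<in> joinings T (M m) \<mu>"
    and cost: "\<And>m. (\<integral>z. pair_dist z \<partial>\<kappa> m) = rho_bar T (M m) \<mu>"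
    by metis
  obtain B where B: "0 < B" "\<And>x. \<bar>f x\<bar> \<le> B" using bounded_continuous[OF X f] by blast
  have fm: "f \<in> borel_measurable borel" by (rule borel_measurable_continuous_onI[OF f])
  have diff: "\<bar>(\<integral>z. f (fst z) * g (snd z) \<partial>\<kappa> m) - (\<integral>x. f x * g x \<partial>\<mu>)\<bar> \<le> e + C * rho_bar T (M m) \<mu>"
    if C: "\<And>x y. \<bar>f x - f y\<bar> \<le> e + C * dist x y" for e C m
  proof -
    note D = joiningsD[OF \<kappa>[of m]]
    interpret prob_space "\<kappa> m" by (rule D(2))
    note meas = borel_measurable_continuous_onI[OF continuous_on_fst[OF continuous_on_id, of "UNIV :: ('a \<times> 'a) set"]]
      borel_measurable_continuous_onI[OF continuous_on_snd[OF continuous_on_id, of "UNIV :: ('a \<times> 'a) set"]]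
    have bd: "\<bar>f x * g y\<bar> \<le> B" for x y
      using mult_mono[OF B(2)[of x] g1[of y]] B(1) by (simp add: abs_mult)
    have i1: "integrable (\<kappa> m) (\<lambda>z. f (fst z) * g (snd z))"
      using measurable_compose[OF meas(1) fm] measurable_compose[OF meas(2) g]
      by (intro bounded_integrable[OF D(1), of _ B] bd borel_measurable_times)
    have i2: "integrable (\<kappa> m) (\<lambda>z. f (snd z) * g (snd z))"
      using measurable_compose[OF meas(2) fm] measurable_compose[OF meas(2) g]
      by (intro bounded_integrable[OF D(1), of _ B] bd borel_measurable_times)
    have "(\<integral>x. f x * g x \<partial>\<mu>) = (\<integral>z. f (snd z) * g (snd z) \<partial>\<kappa> m)"
      using joining_integral(2)[OF \<kappa>[of m], of "\<lambda>x. f x * g x"] fm g by simp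
    then have "(\<integral>z. f (fst z) * g (snd z) \<partial>\<kappa> m) - (\<integral>x. f x * g x \<partial>\<mu>)
        = (\<integral>z. f (fst z) * g (snd z) - f (snd z) * g (snd z) \<partial>\<kappa> m)"
      using i1 i2 by simp
    also have "\<bar>\<dots>\<bar> \<le> (\<integral>z. \<bar>f (fst z) * g (snd z) - f (snd z) * g (snd z)\<bar> \<partial>\<kappa> m)"
      by (rule integral_abs_bound)
    also have "\<dots> \<le> (\<integral>z. \<bar>f (fst z) - f (snd z)\<bar> \<partial>\<kappa> m)"
    proof (rule integral_mono)
      show "\<bar>f (fst z) * g (snd z) - f (snd z) * g (snd z)\<bar> \<le> \<bar>f (fst z) - f (snd z)\<bar>" for z
        using mult_left_mono[OF g1[of "snd z"], of "\<bar>f (fst z) - f (snd z)\<bar>"]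
        by (simp add: left_diff_distrib[symmetric] abs_mult)
    qed (use i1 i2 joining_integral_diff(2)[OF X \<kappa> f C] in auto)
    also have "\<dots> \<le> e + C * rho_bar T (M m) \<mu>"
      using joining_integral_diff(1)[OF X \<kappa> f C] by (simp add: cost)
    finally show ?thesis .
  qed
  have "(\<lambda>m. \<integral>z. f (fst z) * g (snd z) \<partial>\<kappa> m) \<longlonglongrightarrow> (\<integral>x. f x * g x \<partial>\<mu>)"
  proof (rule LIMSEQ_I)
    fix r :: real assume "0 < r"
    then have r2: "0 < r / 2" by simp
    obtain C where C: "0 < C" "\<And>x y. \<bar>f x - f y\<bar> \<le> r / 2 + C * dist x y"
      using linear_modulus[OF X f r2] by blast
    have "\<forall>\<^sub>F m in sequentially. rho_bar T (M m) \<mu> < r / 2 / C"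
      using order_tendstoD(2)[OF lim, of "r / 2 / C"] r2 C(1) by simp
    then obtain N where N: "\<And>m. m \<ge> N \<Longrightarrow> rho_bar T (M m) \<mu> < r / 2 / C"
      by (auto simp: eventually_sequentially)
    show "\<exists>no. \<forall>m\<ge>no. norm ((\<integral>z. f (fst z) * g (snd z) \<partial>\<kappa> m) - (\<integral>x. f x * g x \<partial>\<mu>)) < r"
    proof (intro exI allI impI)
      fix m assume "N \<le> m"
      then have "C * rho_bar T (M m) \<mu> < r / 2" using N[of m] C(1) by (simp add: field_simps)
      then show "norm ((\<integral>z. f (fst z) * g (snd z) \<partial>\<kappa> m) - (\<integral>x. f x * g x \<partial>\<mu>)) < r"
        using diff[OF C(2), of m] unfolding real_norm_def by linarith
    qed
  qed
  with \<kappa> show ?thesis by blast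
qed

text \<open>
  Since \<open>A\<close> is invariant, the integral of \<open>f (fst z)\<close> over \<open>snd z \<in> A\<close> does not change when \<open>f\<close> is
  replaced by its Birkhoff averages, and these converge to the constant \<open>\<integral> f d\<mu>\<close>.
\<close>

lemma ergodic_joining_decorrelates:
  fixes T :: "'a::metric_space \<Rightarrow> 'a" and f :: "'a \<Rightarrow> real"
  assumes T_cont: "continuous_on UNIV T" and \<mu>: "ergodic_measure T \<mu>"
    and \<kappa>: "\<kappa> \<in> joinings T \<mu> \<nu>" and f: "f \<in> borel_measurable borel" and B: "\<And>x. \<bar>f x\<bar> \<le> B"
    and A: "A \<in> sets borel" "T -` A = A"
  shows "(\<integral>z. f (fst z) * indicator A (snd z) \<partial>\<kappa>) = (\<integral>x. f x \<partial>\<mu>) * measure \<nu> A"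
proof -
  note D = joiningsD[OF \<kappa>]
  interpret prob_space \<kappa> by (rule D(2))
  note meas = borel_measurable_continuous_onI[OF continuous_on_fst[OF continuous_on_id, of "UNIV :: ('a \<times> 'a) set"]]
    borel_measurable_continuous_onI[OF continuous_on_snd[OF continuous_on_id, of "UNIV :: ('a \<times> 'a) set"]]
  note T = borel_measurable_continuous_onI[OF T_cont]
    and TT = borel_measurable_continuous_onI[OF continuous_map_prod[OF T_cont]]
  define h where "h = (\<lambda>j (z::'a \<times> 'a). f ((T ^^ j) (fst z)) * indicator A (snd z))"
  have h_meas: "h j \<in> borel_measurable borel" for j
    unfolding h_def
    by (intro borel_measurable_times measurable_compose[OF meas(1) measurable_compose[OF funpow_measurable[OF T] f]]
        measurable_compose[OF meas(2)] borel_measurable_indicator A)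
  have h_bd: "\<bar>h j z\<bar> \<le> B" for j z
    using B[of "(T ^^ j) (fst z)"] order_trans[OF abs_ge_zero B] by (auto simp: h_def indicator_def)
  have h_int: "integrable \<kappa> (h j)" for j
    by (rule bounded_integrable[OF D(1) h_meas h_bd])
  have h_inv: "(\<integral>z. h j z \<partial>\<kappa>) = (\<integral>z. h 0 z \<partial>\<kappa>)" for j
  proof (induction j)
    case (Suc j)
    have "T y \<in> A \<longleftrightarrow> y \<in> A" for y using A(2) by blast
    then have "h (Suc j) z = h j (map_prod T T z)" for z
      by (cases z) (simp add: h_def indicator_def funpow_swap1)
    then show ?case
      using invariant_integral[OF D(1) TT h_meas[of j]] Suc by simp
  qed simp
  define s where "s = (\<lambda>n z. birkhoff_sum T f n (fst z) / real n * indicator A (snd z))"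
  have s_eq: "s n z = (\<Sum>j<n. h j z) / real n" for n z
    by (simp add: s_def h_def birkhoff_sum_def sum_distrib_right)
  have "(\<integral>z. s n z \<partial>\<kappa>) = (\<integral>z. h 0 z \<partial>\<kappa>)" if "0 < n" for n
  proof -
    have "(\<integral>z. s n z \<partial>\<kappa>) = (\<Sum>j<n. \<integral>z. h j z \<partial>\<kappa>) / real n"
      using h_int by (simp add: s_eq Bochner_Integration.integral_sum)
    also have "(\<Sum>j<n. \<integral>z. h j z \<partial>\<kappa>) = (\<Sum>j<n. \<integral>z. h 0 z \<partial>\<kappa>)"
      by (rule sum.cong[OF refl h_inv])
    finally show ?thesis using that by simp
  qed
  then have "(\<lambda>n. \<integral>z. s n z \<partial>\<kappa>) \<longlonglongrightarrow> (\<integral>z. h 0 z \<partial>\<kappa>)"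
    by (intro tendsto_eventually eventually_mono[OF eventually_gt_at_top[of 0]])
  moreover have "(\<lambda>n. \<integral>z. s n z \<partial>\<kappa>) \<longlonglongrightarrow> (\<integral>z. (\<integral>x. f x \<partial>\<mu>) * indicator A (snd z) \<partial>\<kappa>)"
  proof (rule integral_dominated_convergence[where w = "\<lambda>x. B"])
    show "AE z in \<kappa>. (\<lambda>n. s n z) \<longlonglongrightarrow> (\<integral>x. f x \<partial>\<mu>) * indicator A (snd z)"
      using joining_AE(1)[OF \<kappa> birkhoff_ergodic[OF \<mu> T f B]]
      unfolding s_def by eventually_elim (intro tendsto_mult tendsto_const)
    show "AE z in \<kappa>. norm (s n z) \<le> B" for n
    proof (rule AE_I2)
      fix z
      have "\<bar>\<Sum>j<n. h j z\<bar> \<le> real n * B"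
        using order_trans[OF sum_abs[of "\<lambda>j. h j z" "{..<n}"] sum_mono[of "{..<n}" _ "\<lambda>_. B"]] h_bd by simp
      then show "norm (s n z) \<le> B"
        using order_trans[OF abs_ge_zero B] by (cases "n = 0") (auto simp: s_eq field_simps)
    qed
    show "s n \<in> borel_measurable \<kappa>" for n
      unfolding s_eq[abs_def] measurable_cong_sets[OF D(3) refl]
      by (intro borel_measurable_divide borel_measurable_sum h_meas borel_measurable_const)
    show "(\<lambda>z. (\<integral>x. f x \<partial>\<mu>) * indicator A (snd z)) \<in> borel_measurable \<kappa>"
      unfolding measurable_cong_sets[OF D(3) refl]
      by (intro borel_measurable_times borel_measurable_const measurable_compose[OF meas(2)] borel_measurable_indicator A)
  qed simp
  ultimately have "(\<integral>z. h 0 z \<partial>\<kappa>) = (\<integral>z. (\<integral>x. f x \<partial>\<mu>) * indicator A (snd z) \<partial>\<kappa>)"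
    by (rule LIMSEQ_unique)
  also have "\<dots> = (\<integral>x. f x \<partial>\<mu>) * (\<integral>x. indicator A x \<partial>\<nu>)"
    using joining_integral(2)[OF \<kappa> borel_measurable_indicator[OF A(1)]] by simp
  also have "(\<integral>x. indicator A x \<partial>\<nu>) = measure \<nu> A"
    using A D(6) sets_distr[of \<kappa> borel snd] by auto
  finally show ?thesis by (simp add: h_def)
qed


text \<open>
  In the limit, \<open>f\<close> and the indicator of an invariant set \<open>A\<close> are uncorrelated under \<open>\<mu>\<close> itself, for
  every continuous \<open>f\<close>.
\<close>

theorem rho_bar_limit_ergodic:
  fixes T :: "'a::metric_space \<Rightarrow> 'a"
  assumes X: "compact (UNIV :: 'a set)" and T: "continuous_on UNIV T"
    and M: "\<And>m. ergodic_measure T (M m)" and \<mu>: "\<mu> \<in> invariant_measures T"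
    and lim: "(\<lambda>m. rho_bar T (M m) \<mu>) \<longlonglongrightarrow> 0"
  shows "ergodic_measure T \<mu>"
    and "\<And>f :: 'a \<Rightarrow> real. continuous_on UNIV f \<Longrightarrow> (\<lambda>m. \<integral>x. f x \<partial>M m) \<longlonglongrightarrow> (\<integral>x. f x \<partial>\<mu>)"
proof -
  have M_inv: "M m \<in> invariant_measures T" for m
    using M by (simp add: ergodic_measure_def)
  note D = invariant_measuresD[OF \<mu>]
  interpret prob_space \<mu> by (rule D(1))
  show weak: "(\<lambda>m. \<integral>x. f x \<partial>M m) \<longlonglongrightarrow> (\<integral>x. f x \<partial>\<mu>)" if f: "continuous_on UNIV f" for f :: "'a \<Rightarrow> real"
  proof -
    obtain \<kappa> where \<kappa>: "\<And>m. \<kappa> m \<in> joinings T (M m) \<mu>"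
      and "(\<lambda>m. \<integral>z. f (fst z) * 1 \<partial>\<kappa> m) \<longlonglongrightarrow> (\<integral>x. f x * 1 \<partial>\<mu>)"
      using joinings_integral_tendsto[OF X T M_inv \<mu> lim f, of "\<lambda>x. 1"] by auto
    then show ?thesis
      by (simp add: joining_integral(1)[OF \<kappa> borel_measurable_continuous_onI[OF f]])
  qed
  have "measure \<mu> A = 0 \<or> measure \<mu> A = 1" if A: "A \<in> sets borel" "T -` A = A" for A
  proof -
    have A\<mu>: "A \<in> sets \<mu>" using A D by simp
    have A_meas: "indicator A \<in> borel_measurable \<mu>"
      by (rule borel_measurable_indicator[OF A\<mu>])
    have eq: "(\<integral>x. f x * indicator A x \<partial>\<mu>) = (\<integral>x. f x \<partial>\<mu>) * measure \<mu> A"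
      if f: "continuous_on UNIV f" for f :: "'a \<Rightarrow> real"
    proof -
      obtain B where B: "\<And>x. \<bar>f x\<bar> \<le> B" using bounded_continuous[OF X f] by blast
      have "indicator A \<in> borel_measurable borel" by (rule borel_measurable_indicator[OF A(1)])
      then obtain \<kappa> where \<kappa>: "\<And>m. \<kappa> m \<in> joinings T (M m) \<mu>"
        and "(\<lambda>m. \<integral>z. f (fst z) * indicator A (snd z) \<partial>\<kappa> m) \<longlonglongrightarrow> (\<integral>x. f x * indicator A x \<partial>\<mu>)"
        using joinings_integral_tendsto[OF X T M_inv \<mu> lim f, of "indicator A"] by (auto simp: indicator_def)
      then have "(\<lambda>m. (\<integral>x. f x \<partial>M m) * measure \<mu> A) \<longlonglongrightarrow> (\<integral>x. f x * indicator A x \<partial>\<mu>)"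
        by (simp only: ergodic_joining_decorrelates[OF T M \<kappa> borel_measurable_continuous_onI[OF f] B A])
      moreover have "(\<lambda>m. (\<integral>x. f x \<partial>M m) * measure \<mu> A) \<longlonglongrightarrow> (\<integral>x. f x \<partial>\<mu>) * measure \<mu> A"
        by (intro tendsto_intros weak f)
      ultimately show ?thesis by (rule LIMSEQ_unique)
    qed
    \<comment> \<open>The restriction of the measure to A and its multiple by the measure of A agree on
        continuous functions, hence as measures; evaluated at A they give p and p * p, where p is the measure of A.\<close>
    let ?N1 = "density \<mu> (\<lambda>x. ennreal (indicator A x))" and ?N2 = "density \<mu> (\<lambda>x. ennreal (measure \<mu> A))"
    have dens: "(\<integral>x. f x \<partial>?N1) = (\<integral>x. f x * indicator A x \<partial>\<mu>)" "(\<integral>x. f x \<partial>?N2) = (\<integral>x. f x \<partial>\<mu>) * measure \<mu> A"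
      if "f \<in> borel_measurable borel" for f :: "'a \<Rightarrow> real"
      using that A_meas D(2)
      by (subst integral_density; auto simp: measurable_cong_sets[OF D(2) refl] mult.commute)+
    have "?N1 = ?N2"
    proof (rule borel_measure_eqI)
      show "finite_measure ?N1"
        using A\<mu> A_meas by (intro finite_measureI) (simp add: emeasure_density ennreal_indicator)
      show "finite_measure ?N2"
        by (intro finite_measureI) (simp add: emeasure_density ennreal_mult_eq_top_iff)
      fix f :: "'a \<Rightarrow> real" assume f: "continuous_on UNIV f"
      show "(\<integral>x. f x \<partial>?N1) = (\<integral>x. f x \<partial>?N2)"
        by (simp add: dens borel_measurable_continuous_onI[OF f] eq[OF f])
    qed (simp_all add: D)
    with dens[of "indicator A", OF borel_measurable_indicator[OF A(1)]]
    have "(\<integral>x. indicator A x * indicator A x \<partial>\<mu>) = (\<integral>x. indicator A x \<partial>\<mu>) * measure \<mu> A"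
      by metis
    then have "measure \<mu> A = measure \<mu> A * measure \<mu> A"
      using A\<mu> by (simp add: indicator_inter_arith[symmetric])
    then show ?thesis by simp
  qed
  then show "ergodic_measure T \<mu>"
    using \<mu> by (simp add: ergodic_measure_def)
qed

section \<open>Limits of orbits in the Besicovitch pseudometric\<close>

lemma besicovitch_tendsto_0D:
  assumes "(\<lambda>m. besicovitch_along T n y (ys m)) \<longlonglongrightarrow> 0" "0 < e"
  shows "\<forall>\<^sub>F m in sequentially. \<forall>\<^sub>F k in sequentially. orbit_dist_avg T y (ys m) (n k) < e"
proof -
  have "\<forall>\<^sub>F m in sequentially. besicovitch_along T n y (ys m) < ereal e"
    using order_tendstoD(2)[OF assms(1), of "ereal e"] assms(2) by simp
  then show ?thesis
  proof eventually_elim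
    case (elim m)
    then have "\<forall>\<^sub>F k in sequentially. ereal (orbit_dist_avg T y (ys m) (n k)) < ereal e"
      unfolding besicovitch_along_def by (rule Limsup_lessD)
    then show ?case by simp
  qed
qed

lemma birkhoff_average_diff:
  fixes T :: "'a::metric_space \<Rightarrow> 'a"
  assumes C: "\<And>x y. \<bar>f x - f y\<bar> \<le> e + C * dist x y" and e: "0 \<le> e"
  shows "\<bar>birkhoff_sum T f n x / real n - birkhoff_sum T f n y / real n\<bar> \<le> e + C * orbit_dist_avg T x y n"
proof -
  have "\<bar>birkhoff_sum T f n x - birkhoff_sum T f n y\<bar> \<le> (\<Sum>j<n. \<bar>f ((T ^^ j) x) - f ((T ^^ j) y)\<bar>)"
    unfolding birkhoff_sum_def sum_subtractf[symmetric] by (rule sum_abs)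
  also have "\<dots> \<le> (\<Sum>j<n. e + C * dist ((T ^^ j) x) ((T ^^ j) y))"
    by (intro sum_mono C)
  also have "\<dots> = real n * e + C * (\<Sum>j<n. dist ((T ^^ j) x) ((T ^^ j) y))"
    by (simp add: sum.distrib sum_distrib_left)
  finally have "\<bar>birkhoff_sum T f n x - birkhoff_sum T f n y\<bar> / real n
      \<le> (real n * e + C * (\<Sum>j<n. dist ((T ^^ j) x) ((T ^^ j) y))) / real n"
    by (rule divide_right_mono) simp
  also have "\<dots> \<le> e + C * orbit_dist_avg T x y n"
    using e by (cases "n = 0") (auto simp: orbit_dist_avg_def add_divide_distrib)
  finally show ?thesis
    by (simp add: diff_divide_distrib[symmetric])
qed

lemma birkhoff_average_eventually_close:
  fixes T :: "'a::metric_space \<Rightarrow> 'a" and f :: "'a \<Rightarrow> real"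
  assumes X: "compact (UNIV :: 'a set)" and f: "continuous_on UNIV f"
    and lim: "(\<lambda>m. besicovitch_along T n y (ys m)) \<longlonglongrightarrow> 0" and e: "0 < e"
  shows "\<forall>\<^sub>F m in sequentially. \<forall>\<^sub>F k in sequentially.
    \<bar>birkhoff_sum T f (n k) y / real (n k) - birkhoff_sum T f (n k) (ys m) / real (n k)\<bar> < e"
proof -
  have e2: "0 < e / 2" using e by simp
  obtain C where C: "0 < C" "\<And>x y. \<bar>f x - f y\<bar> \<le> e / 2 + C * dist x y"
    using linear_modulus[OF X f e2] by blast
  have "0 < e / 2 / C" using e C by simp
  from besicovitch_tendsto_0D[OF lim this] show ?thesis
  proof eventually_elim
    case (elim m)
    then show ?case
    proof eventually_elim
      case (elim k)
      then have "C * orbit_dist_avg T y (ys m) (n k) < e / 2"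
        using C(1) by (simp add: field_simps)
      then show ?case
        using birkhoff_average_diff[of f "e / 2" C T "n k" y "ys m", OF C(2)] e by linarith
    qed
  qed
qed

theorem besicovitch_limit_quasi_generic:
  fixes T :: "'a::metric_space \<Rightarrow> 'a"
  assumes X: "compact (UNIV :: 'a set)"
    and M: "\<And>m. M m \<in> invariant_measures T" and \<mu>: "\<mu> \<in> invariant_measures T"
    and weak: "\<And>f :: 'a \<Rightarrow> real. continuous_on UNIV f \<Longrightarrow> (\<lambda>m. \<integral>x. f x \<partial>M m) \<longlonglongrightarrow> (\<integral>x. f x \<partial>\<mu>)"
    and ys: "\<And>m. quasi_generic T n (M m) (ys m)"
    and lim: "(\<lambda>m. besicovitch_along T n y (ys m)) \<longlonglongrightarrow> 0"
  shows "quasi_generic T n \<mu> y"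
  unfolding quasi_generic_iff_real[OF X invariant_measuresD(1,2)[OF \<mu>]]
proof (intro allI impI LIMSEQ_I)
  fix f :: "'a \<Rightarrow> real" and r :: real assume f: "continuous_on UNIV f" and "0 < r"
  then have e: "0 < r / 3" by simp
  have "\<forall>\<^sub>F m in sequentially. \<bar>(\<integral>x. f x \<partial>M m) - (\<integral>x. f x \<partial>\<mu>)\<bar> < r / 3"
    using tendstoD[OF weak[OF f] e] by (simp add: dist_real_def)
  with birkhoff_average_eventually_close[OF X f lim e]
  have "\<forall>\<^sub>F m in sequentially. \<bar>(\<integral>x. f x \<partial>M m) - (\<integral>x. f x \<partial>\<mu>)\<bar> < r / 3 \<and>
     (\<forall>\<^sub>F k in sequentially.
       \<bar>birkhoff_sum T f (n k) y / real (n k) - birkhoff_sum T f (n k) (ys m) / real (n k)\<bar> < r / 3)"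
    by eventually_elim simp
  then obtain m where m: "\<bar>(\<integral>x. f x \<partial>M m) - (\<integral>x. f x \<partial>\<mu>)\<bar> < r / 3"
    and close: "\<forall>\<^sub>F k in sequentially.
       \<bar>birkhoff_sum T f (n k) y / real (n k) - birkhoff_sum T f (n k) (ys m) / real (n k)\<bar> < r / 3"
    using eventually_happens'[OF sequentially_bot] by blast
  have "(\<lambda>k. birkhoff_sum T f (n k) (ys m) / real (n k)) \<longlonglongrightarrow> (\<integral>x. f x \<partial>M m)"
    using ys[of m] f unfolding quasi_generic_iff_real[OF X invariant_measuresD(1,2)[OF M]] by blast
  from tendstoD[OF this e] close
  have "\<forall>\<^sub>F k in sequentially. norm (birkhoff_sum T f (n k) y / real (n k) - (\<integral>x. f x \<partial>\<mu>)) < r"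
  proof eventually_elim
    case (elim k)
    have triangle: "\<bar>a - d\<bar> < r" if "\<bar>a - b\<bar> < r / 3" "\<bar>b - c\<bar> < r / 3" "\<bar>c - d\<bar> < r / 3" for a b c d
      using that by linarith
    show ?case
      unfolding real_norm_def by (rule triangle[OF elim(2) _ m]) (use elim(1) in \<open>simp add: dist_real_def\<close>)
  qed
  then show "\<exists>no. \<forall>k\<ge>no. norm (birkhoff_sum T f (n k) y / real (n k) - (\<integral>x. f x \<partial>\<mu>)) < r"
    by (simp add: eventually_sequentially)
qed

text \<open>
  The limit measure is any weak limit point of the empirical measures of \<open>y\<close>. The weak convergence of
  \<open>M m\<close> to it shows that there is only one limit point, so that \<open>y\<close> is quasi-generic; only then can
  the lower bound for orbit distances of quasi-generic pairs be applied to \<open>ys m\<close> and \<open>y\<close>.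
\<close>

theorem besicovitch_limit_rho_bar:
  fixes T :: "'a::metric_space \<Rightarrow> 'a"
  assumes X: "compact (UNIV :: 'a set)" and T: "continuous_on UNIV T"
    and M: "\<And>m. M m \<in> invariant_measures T" and n: "filterlim n at_top sequentially"
    and ys: "\<And>m. quasi_generic T n (M m) (ys m)"
    and lim: "(\<lambda>m. besicovitch_along T n y (ys m)) \<longlonglongrightarrow> 0"
  shows "\<exists>\<mu>\<in>invariant_measures T. (\<lambda>m. rho_bar T (M m) \<mu>) \<longlonglongrightarrow> 0"
proof -
  from empirical_cluster[OF X T n, of y] obtain G \<mu>
    where G: "G \<le> sequentially" "G \<noteq> bot" and \<mu>: "\<mu> \<in> invariant_measures T"
    and cluster: "\<And>f. continuous_on UNIV f \<Longrightarrow> ((\<lambda>k. birkhoff_sum T f (n k) y / real (n k)) \<longlongrightarrow> (\<integral>x. f x \<partial>\<mu>)) G"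
    by blast
  have weak: "(\<lambda>m. \<integral>x. f x \<partial>M m) \<longlonglongrightarrow> (\<integral>x. f x \<partial>\<mu>)" if f: "continuous_on UNIV f" for f :: "'a \<Rightarrow> real"
  proof (rule tendstoI)
    fix r :: real assume "0 < r"
    then have e: "0 < r / 2" by simp
    from birkhoff_average_eventually_close[OF X f lim e]
    show "\<forall>\<^sub>F m in sequentially. dist (\<integral>x. f x \<partial>M m) (\<integral>x. f x \<partial>\<mu>) < r"
    proof eventually_elim
      case (elim m)
      have "(\<lambda>k. birkhoff_sum T f (n k) (ys m) / real (n k)) \<longlonglongrightarrow> (\<integral>x. f x \<partial>M m)"
        using ys[of m] f unfolding quasi_generic_iff_real[OF X invariant_measuresD(1,2)[OF M]] by blast
      then have "((\<lambda>k. birkhoff_sum T f (n k) (ys m) / real (n k)) \<longlongrightarrow> (\<integral>x. f x \<partial>M m)) G"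
        using G(1) by (rule tendsto_mono[rotated])
      from tendsto_rabs[OF tendsto_diff[OF cluster[OF f] this]]
      have "\<bar>(\<integral>x. f x \<partial>\<mu>) - (\<integral>x. f x \<partial>M m)\<bar> \<le> r / 2"
      proof (rule tendsto_upperbound[OF _ _ G(2)])
        show "\<forall>\<^sub>F k in G. \<bar>birkhoff_sum T f (n k) y / real (n k) - birkhoff_sum T f (n k) (ys m) / real (n k)\<bar> \<le> r / 2"
          using filter_leD[OF G(1) elim] by eventually_elim simp
      qed
      then show ?case using \<open>0 < r\<close> by (simp add: dist_real_def abs_minus_commute)
    qed
  qed
  have y: "quasi_generic T n \<mu> y"
    by (rule besicovitch_limit_quasi_generic[OF X M \<mu> weak ys lim])
  have "(\<lambda>m. rho_bar T (M m) \<mu>) \<longlonglongrightarrow> 0"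
  proof (rule order_tendstoI)
    fix a :: real assume "a < 0"
    then show "\<forall>\<^sub>F m in sequentially. a < rho_bar T (M m) \<mu>"
      by (intro always_eventually allI less_le_trans[OF _ rho_bar_nonneg[OF joinings_nonempty[OF X T M \<mu>]]])
  next
    fix a :: real assume "0 < a"
    then have "0 < a / 2" by simp
    from besicovitch_tendsto_0D[OF lim this] show "\<forall>\<^sub>F m in sequentially. rho_bar T (M m) \<mu> < a"
    proof eventually_elim
      case (elim m)
      have "\<forall>\<^sub>F k in sequentially. orbit_dist_avg T (ys m) y (n k) \<le> a / 2"
        using elim by eventually_elim (simp add: orbit_dist_avg_commute[of T "ys m"])
      then have "rho_bar T (M m) \<mu> \<le> a / 2"
        by (intro rho_bar_le_of_frequently[OF X T M \<mu> n ys y] eventually_frequently) simp_all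
      then show ?case using \<open>0 < a\<close> by simp
    qed
  qed
  with \<mu> show ?thesis by blast
qed

section \<open>Convergence of measures and of orbits\<close>

theorem optimal_generic_points:
  fixes T :: "'a::metric_space \<Rightarrow> 'a" and M :: "nat \<Rightarrow> 'a measure"
  assumes X: "compact (UNIV :: 'a set)" and T: "continuous_on UNIV T"
    and M: "\<And>m. ergodic_measure T (M m)" and \<mu>: "ergodic_measure T \<mu>"
  shows "\<exists>xs x. \<forall>m. xs m \<in> Gen T (M m) \<and> orbit_dist_avg T x (xs m) \<longlonglongrightarrow> rho_bar T (M m) \<mu> \<and>
    besicovitch T x (xs m) = ereal (rho_bar T (M m) \<mu>)"
proof -
  have inv: "\<mu> \<in> invariant_measures T" using \<mu> by (simp add: ergodic_measure_def)
  interpret prob_space \<mu> by (rule invariant_measuresD(1)[OF inv])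
  have "AE x in \<mu>. \<forall>m. \<exists>x'. x' \<in> Gen T (M m) \<and> orbit_dist_avg T x' x \<longlonglongrightarrow> rho_bar T (M m) \<mu>"
    unfolding AE_all_countable by (intro allI AE_optimal_generic X T M \<mu>)
  then obtain x where "\<forall>m. \<exists>x'. x' \<in> Gen T (M m) \<and> orbit_dist_avg T x' x \<longlonglongrightarrow> rho_bar T (M m) \<mu>"
    using eventually_happens'[OF ae_filter_bot] by blast
  then obtain xs where xs: "\<And>m. xs m \<in> Gen T (M m)"
    and conv: "\<And>m. orbit_dist_avg T (xs m) x \<longlonglongrightarrow> rho_bar T (M m) \<mu>"
    by metis
  have conv': "orbit_dist_avg T x (xs m) \<longlonglongrightarrow> rho_bar T (M m) \<mu>" for m
    using conv[of m] by (simp add: orbit_dist_avg_commute[of T x, abs_def])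
  have "besicovitch T x (xs m) = ereal (rho_bar T (M m) \<mu>)" for m
    unfolding besicovitch_def besicovitch_along_def
    using conv'[of m] by (intro lim_imp_Limsup) simp_all
  with xs conv' show ?thesis
    by (intro exI[of _ xs] exI[of _ x]) simp
qed

theorem corollary7p6:
  fixes T :: "'a::metric_space \<Rightarrow> 'a"
    and M :: "nat \<Rightarrow> 'a measure"
  assumes "compact (UNIV :: 'a set)"
    and "\<exists>T'. homeomorphism UNIV UNIV T T'"
    and "\<And>m. ergodic_measure T (M m)"
  shows
    "((\<exists>\<mu>\<in>invariant_measures T. (\<lambda>m. rho_bar T (M m) \<mu>) \<longlonglongrightarrow> 0)
        \<longleftrightarrow> (\<exists>xs x. (\<forall>m. xs m \<in> Gen T (M m)) \<and> (\<lambda>m. besicovitch T x (xs m)) \<longlonglongrightarrow> 0))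
     \<and>
     ((\<exists>xs x. (\<forall>m. xs m \<in> Gen T (M m)) \<and> (\<lambda>m. besicovitch T x (xs m)) \<longlonglongrightarrow> 0)
        \<longleftrightarrow> (\<exists>n ys y. strict_mono n \<and> 0 < n 0 \<and> (\<forall>m. quasi_generic T n (M m) (ys m))
               \<and> (\<lambda>m. besicovitch_along T n y (ys m)) \<longlonglongrightarrow> 0))
     \<and>
     (\<forall>\<mu>\<in>invariant_measures T. (\<lambda>m. rho_bar T (M m) \<mu>) \<longlonglongrightarrow> 0 \<longrightarrow>
        ergodic_measure T \<mu>
        \<and> (\<forall>xs x. (\<forall>m. xs m \<in> Gen T (M m)) \<and> (\<lambda>m. besicovitch T x (xs m)) \<longlonglongrightarrow> 0
              \<longrightarrow> x \<in> Gen T \<mu>)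
        \<and> (\<forall>n ys y. strict_mono n \<and> 0 < n 0 \<and> (\<forall>m. quasi_generic T n (M m) (ys m))
               \<and> (\<lambda>m. besicovitch_along T n y (ys m)) \<longlonglongrightarrow> 0
              \<longrightarrow> quasi_generic T n \<mu> y)
        \<and> (\<exists>xs x. (\<forall>m. xs m \<in> Gen T (M m)) \<and> (\<lambda>m. besicovitch T x (xs m)) \<longlonglongrightarrow> 0
              \<and> (\<forall>m. besicovitch T x (xs m) = ereal (rho_bar T (M m) \<mu>)
                    \<and> orbit_dist_avg T x (xs m) \<longlonglongrightarrow> rho_bar T (M m) \<mu>)))"
proof -
  note X = assms(1) and M = assms(3)
  have T: "continuous_on UNIV T"
    using assms(2) by (auto simp: homeomorphism_def)
  have M_inv: "M m \<in> invariant_measures T" for m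
    using M by (simp add: ergodic_measure_def)
  let ?P1 = "\<lambda>\<mu>. (\<lambda>m. rho_bar T (M m) \<mu>) \<longlonglongrightarrow> 0"
  let ?P2 = "\<lambda>xs x. (\<forall>m. xs m \<in> Gen T (M m)) \<and> (\<lambda>m. besicovitch T x (xs m)) \<longlonglongrightarrow> 0"
  let ?P3 = "\<lambda>n ys y. strict_mono n \<and> 0 < n 0 \<and> (\<forall>m. quasi_generic T n (M m) (ys m))
               \<and> (\<lambda>m. besicovitch_along T n y (ys m)) \<longlonglongrightarrow> 0"
  have ergodic: "ergodic_measure T \<mu>" if "\<mu> \<in> invariant_measures T" "?P1 \<mu>" for \<mu>
    by (rule rho_bar_limit_ergodic(1)[OF X T M that])
  have optimal: "\<exists>xs x. ?P2 xs x \<and> (\<forall>m. besicovitch T x (xs m) = ereal (rho_bar T (M m) \<mu>)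
      \<and> orbit_dist_avg T x (xs m) \<longlonglongrightarrow> rho_bar T (M m) \<mu>)"
    if \<mu>: "\<mu> \<in> invariant_measures T" "?P1 \<mu>" for \<mu>
  proof -
    have "\<exists>xs x. \<forall>m. xs m \<in> Gen T (M m) \<and> orbit_dist_avg T x (xs m) \<longlonglongrightarrow> rho_bar T (M m) \<mu> \<and>
        besicovitch T x (xs m) = ereal (rho_bar T (M m) \<mu>)"
      by (rule optimal_generic_points[OF X T M ergodic[OF \<mu>]])
    then obtain xs x
      where xs: "\<forall>m. xs m \<in> Gen T (M m) \<and> orbit_dist_avg T x (xs m) \<longlonglongrightarrow> rho_bar T (M m) \<mu> \<and>
        besicovitch T x (xs m) = ereal (rho_bar T (M m) \<mu>)"
      by (elim exE)
    have "(\<lambda>m. ereal (rho_bar T (M m) \<mu>)) \<longlonglongrightarrow> ereal 0"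
      using \<mu>(2) by simp
    then have "(\<lambda>m. besicovitch T x (xs m)) \<longlonglongrightarrow> 0"
      using xs by (simp add: zero_ereal_def)
    with xs show ?thesis
      by (intro exI[of _ xs] exI[of _ x]) simp
  qed
  \<comment> \<open>Reindexing by Suc turns genericity into quasi-genericity along a sequence with positive first term.\<close>
  have along_Suc: "\<exists>n ys y. ?P3 n ys y" if P2: "?P2 xs x" for xs x
  proof -
    have "quasi_generic T Suc (M m) (xs m)" for m
    proof -
      have q: "quasi_generic T (\<lambda>k. k) (M m) (xs m)"
        using P2 by (simp add: Gen_def)
      show ?thesis
        unfolding quasi_generic_def
      proof (intro allI impI)
        fix f :: "'a \<Rightarrow> complex" assume "continuous_on UNIV f"
        with q have "(\<lambda>k. (1 / of_nat k) * (\<Sum>j<k. f ((T ^^ j) (xs m)))) \<longlonglongrightarrow> integral\<^sup>L (M m) f"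
          unfolding quasi_generic_def by blast
        from LIMSEQ_Suc[OF this]
        show "(\<lambda>k. (1 / of_nat (Suc k)) * (\<Sum>j<Suc k. f ((T ^^ j) (xs m)))) \<longlonglongrightarrow> integral\<^sup>L (M m) f" .
      qed
    qed
    moreover have "besicovitch_along T Suc x (xs m) = besicovitch T x (xs m)" for m
      unfolding besicovitch_def besicovitch_along_def
      using limsup_shift[of "\<lambda>k. ereal (orbit_dist_avg T x (xs m) k)"] by simp
    ultimately have "?P3 Suc xs x"
      using P2 by (simp add: strict_mono_def)
    then show ?thesis by blast
  qed
  have along: "\<exists>\<mu>\<in>invariant_measures T. ?P1 \<mu>" if P3: "?P3 n ys y" for n ys y
    using P3 by (intro besicovitch_limit_rho_bar[OF X T M_inv]) (auto intro: filterlim_subseq)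
  have gen: "x \<in> Gen T \<mu>" if "\<mu> \<in> invariant_measures T" "?P1 \<mu>" "?P2 xs x" for \<mu> xs x
    using besicovitch_limit_quasi_generic[OF X M_inv that(1) rho_bar_limit_ergodic(2)[OF X T M that(1,2)],
        of "\<lambda>k. k" xs x] that(3)
    by (simp add: Gen_def besicovitch_def)
  have qgen: "quasi_generic T n \<mu> y" if "\<mu> \<in> invariant_measures T" "?P1 \<mu>" "?P3 n ys y" for \<mu> n ys y
    using besicovitch_limit_quasi_generic[OF X M_inv that(1) rho_bar_limit_ergodic(2)[OF X T M that(1,2)],
        of n ys y] that(3)
    by simp
  have equiv12: "(\<exists>\<mu>\<in>invariant_measures T. ?P1 \<mu>) \<longleftrightarrow> (\<exists>xs x. ?P2 xs x)"
    using optimal along along_Suc by meson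
  have equiv23: "(\<exists>xs x. ?P2 xs x) \<longleftrightarrow> (\<exists>n ys y. ?P3 n ys y)"
    using along_Suc along equiv12 by meson
  have "\<forall>\<mu>\<in>invariant_measures T. ?P1 \<mu> \<longrightarrow> ergodic_measure T \<mu>
        \<and> (\<forall>xs x. ?P2 xs x \<longrightarrow> x \<in> Gen T \<mu>)
        \<and> (\<forall>n ys y. ?P3 n ys y \<longrightarrow> quasi_generic T n \<mu> y)
        \<and> (\<exists>xs x. (\<forall>m. xs m \<in> Gen T (M m)) \<and> (\<lambda>m. besicovitch T x (xs m)) \<longlonglongrightarrow> 0
              \<and> (\<forall>m. besicovitch T x (xs m) = ereal (rho_bar T (M m) \<mu>)
                    \<and> orbit_dist_avg T x (xs m) \<longlonglongrightarrow> rho_bar T (M m) \<mu>))"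
  proof (intro ballI impI conjI allI)
    fix \<mu> assume \<mu>: "\<mu> \<in> invariant_measures T" "?P1 \<mu>"
    show "ergodic_measure T \<mu>" by (rule ergodic[OF \<mu>])
    show "x \<in> Gen T \<mu>" if "?P2 xs x" for xs x by (rule gen[OF \<mu> that])
    show "quasi_generic T n \<mu> y" if "?P3 n ys y" for n ys y by (rule qgen[OF \<mu> that])
    show "\<exists>xs x. (\<forall>m. xs m \<in> Gen T (M m)) \<and> (\<lambda>m. besicovitch T x (xs m)) \<longlonglongrightarrow> 0
              \<and> (\<forall>m. besicovitch T x (xs m) = ereal (rho_bar T (M m) \<mu>)
                    \<and> orbit_dist_avg T x (xs m) \<longlonglongrightarrow> rho_bar T (M m) \<mu>)"
      using optimal[OF \<mu>] by (simp only: conj_assoc)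
  qed
  with equiv12 equiv23 show ?thesis by (intro conjI)
qed

end
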